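(* Let $d\ge2$, let $f\in\mathcal P_{d,1}$, let $\zeta$ be a root of $f$, and let $z\in\operatorname{Basin}(\zeta)$ with $|z|=r>1$. Then $$|f(z)|\ge s_r\cdot\rho_\zeta,$$ where $s_r<1$ is defined as follows: if $r>1+\frac{2\pi}{d}$, then $s_r=\frac14$; otherwise, writing $r=1+\frac Cd$ (so $0<C\le2\pi$), $s_r$ is the smallest positive solution $s$ of $$C=8\pi\,\frac{s}{(1-s)^2}.$$
   Context: $\mathcal P_{d,1}$ is the set of monic complex polynomials $f(z)=\prod_{j=1}^d(z-\zeta_j)$ of degree $d$ with distinct roots satisfying $|\zeta_j|\le1$. $\operatorname{Basin}(\zeta)$ is the set of points whose forward trajectory under the Newton flow $\dot z=-f(z)/f'(z)$ (equivalently, after rescaling time, $\dot z=-\nabla|f(z)|^2$) converges to $\zeta$. $\rho_\zeta=\min\{|f(c)|: f'(c)=0,\ c\in\overline{\operatorname{Basin}(\zeta)}\}$, which is the radius of convergence at $0$ of the branch of $f^{-1}$ taking $0$ to $\zeta$. *)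

theory Defs
  imports "HOL-Analysis.Analysis" "HOL-Computational_Algebra.Polynomial"
begin

definition polys_in_unit_disk :: "nat \<Rightarrow> complex poly set" where
  "polys_in_unit_disk d =
     {f. \<exists>Z. finite Z \<and> card Z = d \<and> (\<forall>\<zeta>\<in>Z. cmod \<zeta> \<le> 1) \<and> f = (\<Prod>\<zeta>\<in>Z. [:- \<zeta>, 1:])}"

text \<open>
  The vector field is undefined at critical points, so the trajectory is required to avoid them
  (otherwise HOL's convention \<open>w / 0 = 0\<close> would turn them into equilibria).
  A maximal solution that exists only for a finite time ends at a critical point that is not a
  root, so only trajectories on all of \<open>{0..}\<close> are relevant for the basins of the roots.
\<close>

definition newton_trajectory :: "complex poly \<Rightarrow> complex \<Rightarrow> (real \<Rightarrow> complex) \<Rightarrow> bool" where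
  "newton_trajectory f z \<gamma> \<longleftrightarrow> \<gamma> 0 = z \<and>
     (\<forall>t\<ge>0. poly (pderiv f) (\<gamma> t) \<noteq> 0 \<and>
        (\<gamma> has_vector_derivative - (poly f (\<gamma> t) / poly (pderiv f) (\<gamma> t))) (at t within {0..}))"

definition Basin :: "complex poly \<Rightarrow> complex \<Rightarrow> complex set" where
  "Basin f \<zeta> = {z. \<exists>\<gamma>. newton_trajectory f z \<gamma> \<and> (\<gamma> \<longlongrightarrow> \<zeta>) at_top}"

definition basin_radius :: "complex poly \<Rightarrow> complex \<Rightarrow> real" where
  "basin_radius f \<zeta> =
     Min {cmod (poly f c) | c. poly (pderiv f) c = 0 \<and> c \<in> closure (Basin f \<zeta>)}"

text \<open>
  The number \<open>s\<^sub>r\<close>, which also depends on the degree \<open>d\<close>; here \<open>real d * (r - 1)\<close> is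
  the number \<open>C\<close> with \<open>r = 1 + C / d\<close>.
\<close>

definition s_bound :: "nat \<Rightarrow> real \<Rightarrow> real" where
  "s_bound d r =
     (if r > 1 + 2 * pi / real d then 1 / 4
      else (LEAST s. 0 < s \<and> real d * (r - 1) = 8 * pi * (s / (1 - s)\<^sup>2)))"

text \<open>The least solution exists and is below 1, so the \<open>LEAST\<close> above is meaningful.\<close>

lemma least_koebe_solution:
  fixes C :: real
  assumes "0 < C"
  defines "P \<equiv> \<lambda>s. 0 < s \<and> C = 8 * pi * (s / (1 - s)\<^sup>2)"
  shows "P (Least P)" "Least P < 1" "\<And>s. P s \<Longrightarrow> Least P \<le> s"
proof -
  define a where "a = 4 * pi / C"
  have a: "a > 0" using assms by (simp add: a_def)
  define q where "q = sqrt (a\<^sup>2 + 2 * a)"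
  have q2: "q\<^sup>2 = a\<^sup>2 + 2 * a" using a by (simp add: q_def)
  have q0: "q > 0" using a by (simp add: q_def add_pos_pos)
  have qa: "q > a" 
    using q2 a q0 by (metis less_add_same_cancel1 mult_pos_pos power2_less_imp_less less_imp_le zero_less_numeral)
  have "q\<^sup>2 < (1 + a)\<^sup>2" unfolding q2 by (simp add: power2_eq_square algebra_simps)
  hence qa1: "q < 1 + a" using a by (meson add_nonneg_nonneg less_imp_le power2_less_imp_less zero_le_one)
  define s0 where "s0 = 1 + a - q"
  have s0: "0 < s0" "s0 < 1" using qa qa1 by (auto simp: s0_def)
  have eq: "(C = 8 * pi * (s / (1 - s)\<^sup>2)) \<longleftrightarrow> (s - s0) * (s - (1 + a + q)) = 0"
    if "s \<noteq> 1" for s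
  proof -
    have "(C = 8 * pi * (s / (1 - s)\<^sup>2)) \<longleftrightarrow> C * (1 - s)\<^sup>2 = C * (2 * a * s)"
      using that assms(1) by (simp add: a_def field_simps)
    also have "\<dots> \<longleftrightarrow> (1 - s)\<^sup>2 = 2 * a * s" using assms(1) by simp
    also have "\<dots> \<longleftrightarrow> (s - (1 + a))\<^sup>2 - q\<^sup>2 = 0"
      unfolding q2 by (auto simp: power2_eq_square algebra_simps)
    also have "(s - (1 + a))\<^sup>2 - q\<^sup>2 = (s - s0) * (s - (1 + a + q))"
      by (simp add: s0_def power2_eq_square algebra_simps)
    finally show ?thesis .
  qed
  have P0: "P s0" using s0 eq[of s0] by (simp add: P_def)
  have min: "s0 \<le> s" if "P s" for s
  proof (cases "s < 1")
    case True
    thus ?thesis using that eq[of s] a q0 by (auto simp: P_def)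
  next
    case False
    thus ?thesis using s0 by simp
  qed
  have "Least P = s0" using P0 min by (intro Least_equality) auto
  thus "P (Least P)" "Least P < 1" "\<And>s. P s \<Longrightarrow> Least P \<le> s" using P0 s0 min by auto
qed

lemma s_bound_less_1: "0 < s_bound d r" "s_bound d r < 1" if "d > 0" "r > 1"
  using least_koebe_solution(1,2)[of "real d * (r - 1)"] that by (auto simp: s_bound_def)

end

theory Submission
  imports Defs "HOL-Complex_Analysis.Complex_Analysis"
begin

unbundle no fps_syntax

text \<open>
  Let \<open>g\<close> be the branch of \<open>f\<inverse>\<close> with \<open>g 0 = \<zeta>\<close> on its maximal disc of radius \<open>R \<ge> \<rho>\<^sub>\<zeta>\<close>. It is univalent, so
  if it omits \<open>b\<close> then Koebe's quarter theorem, applied at every point and integrated, gives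
  \<open>|g w - \<zeta>| \<le> 4 s / (1 - s)\<^sup>2 |\<zeta> - b|\<close> with \<open>s = |w| / R\<close>. Outside the unit disc \<open>Re (z f' / f) > d / 2\<close>, hence
  the Newton flow points inwards and the image of \<open>g\<close> contains no arc of angle \<open>4 \<pi> / d\<close> of a circle of
  radius above \<open>1\<close>; so it omits points \<open>b\<close> whose distance to \<open>\<zeta>\<close> is arbitrarily close to
  \<open>1 - |\<zeta>| + 2 \<pi> / d\<close>. If the Koebe factor is at most \<open>1\<close>, this yields \<open>|g w| \<le> 1 + 4 s / (1 - s)\<^sup>2 \<cdot> 2 \<pi> / d\<close>, which is the case
  \<open>r \<le> 1 + 2 \<pi> / d\<close>. For larger \<open>r\<close> the same estimate is used at an intermediate point of the
  trajectory, and from there on \<open>|f|\<close> grows at least like \<open>(1 + |z|) ^ d\<close>; for \<open>d \<le> 3\<close> the trivial bounds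
  \<open>|f z| \<ge> (r - 1) ^ d\<close> and \<open>R \<le> 2 ^ d\<close> suffice.
\<close>

subsection \<open>Areas of holomorphic images\<close>

text \<open>The change of variables formula used below concerns maps of \<open>real^2\<close> and
  their determinants; \<open>complex_of_vec\<close> and \<open>vec_of_complex\<close> carry complex
  functions there.\<close>

definition complex_of_vec :: "real^2 \<Rightarrow> complex" where
  "complex_of_vec v = Complex (v $ 1) (v $ 2)"

definition vec_of_complex :: "complex \<Rightarrow> real^2" where
  "vec_of_complex z = vector [Re z, Im z]"

lemma vec_of_complex_nth [simp]: "vec_of_complex z $ 1 = Re z" "vec_of_complex z $ 2 = Im z"
  by (simp_all add: vec_of_complex_def)

lemma complex_of_vec_inverse [simp]: "vec_of_complex (complex_of_vec v) = v"
  by (simp add: vec_eq_iff forall_2 complex_of_vec_def)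

lemma vec_of_complex_inverse [simp]: "complex_of_vec (vec_of_complex z) = z"
  by (simp add: complex_of_vec_def complex_eq_iff)

lemma bounded_linear_complex_of_vec: "bounded_linear complex_of_vec"
  by (rule linear_conv_bounded_linear[THEN iffD1], rule linearI)
     (simp_all add: complex_of_vec_def complex_eq_iff)

lemma bounded_linear_vec_of_complex: "bounded_linear vec_of_complex"
  by (rule linear_conv_bounded_linear[THEN iffD1], rule linearI)
     (simp_all add: vec_eq_iff forall_2)

lemma has_derivative_conjugate_vec:
  assumes "(F has_field_derivative D) (at (complex_of_vec v))"
  shows "((\<lambda>v. vec_of_complex (F (complex_of_vec v))) has_derivative
           (\<lambda>h. vec_of_complex (D * complex_of_vec h))) (at v within S)"
proof -
  have 1: "(complex_of_vec has_derivative complex_of_vec) (at v within S)"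
    by (rule bounded_linear_imp_has_derivative[OF bounded_linear_complex_of_vec])
  have 2: "(F has_derivative (*) D) (at (complex_of_vec v))"
    using assms by (simp add: has_field_derivative_def)
  have "((\<lambda>v. F (complex_of_vec v)) has_derivative (\<lambda>h. D * complex_of_vec h)) (at v within S)"
    using has_derivative_compose[OF 1 2] by simp
  then show ?thesis
    by (rule bounded_linear.has_derivative[OF bounded_linear_vec_of_complex])
qed

text \<open>Multiplication by p + i q has the real matrix with rows (p, -q) and (q, p), whose
  determinant is p^2 + q^2.\<close>

lemma det_conjugate_vec:
  "det (matrix (\<lambda>h. vec_of_complex (D * complex_of_vec h))) = (cmod D)\<^sup>2"
  unfolding det_2 matrix_def cmod_power2
  by (simp add: complex_of_vec_def axis_def power2_eq_square)

text \<open>Change of variables: read on \<open>real^2\<close>, a holomorphic map has Jacobian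
  |F'|^2.\<close>

lemma measure_holomorphic_image:
  assumes S: "open S" "F holomorphic_on S" and sub: "complex_of_vec ` cbox u v \<subseteq> S"
    and inj: "inj_on F (complex_of_vec ` cbox u v)"
  shows "(\<lambda>x. vec_of_complex (F (complex_of_vec x))) ` cbox u v \<in> lmeasurable"
    and "measure lebesgue ((\<lambda>x. vec_of_complex (F (complex_of_vec x))) ` cbox u v) =
           integral (cbox u v) (\<lambda>x. (cmod (deriv F (complex_of_vec x)))\<^sup>2)"
proof -
  let ?G = "\<lambda>x. vec_of_complex (F (complex_of_vec x))"
  let ?G' = "\<lambda>x h. vec_of_complex (deriv F (complex_of_vec x) * complex_of_vec h)"
  have der: "(?G has_derivative ?G' x) (at x within cbox u v)" if "x \<in> cbox u v" for x
    using that sub S by (intro has_derivative_conjugate_vec holomorphic_derivI[of F S]) auto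
  have inj': "inj_on ?G (cbox u v)"
  proof (rule inj_onI)
    fix x y assume xy: "x \<in> cbox u v" "y \<in> cbox u v" "?G x = ?G y"
    hence "F (complex_of_vec x) = F (complex_of_vec y)" by (metis vec_of_complex_inverse)
    hence "complex_of_vec x = complex_of_vec y" using inj xy by (auto dest: inj_onD)
    thus "x = y" by (metis complex_of_vec_inverse)
  qed
  have cont: "continuous_on (cbox u v) (\<lambda>x. deriv F (complex_of_vec x))"
    using continuous_on_compose2[OF holomorphic_on_imp_continuous_on[OF holomorphic_deriv[OF S(2,1)]]
      linear_continuous_on[OF bounded_linear_complex_of_vec] sub] .
  have int: "(\<lambda>x. \<bar>det (matrix (?G' x))\<bar>) integrable_on cbox u v"
    unfolding det_conjugate_vec
    by (intro integrable_continuous continuous_intros cont)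
  have S: "cbox u v \<in> sets lebesgue" by simp
  show "?G ` cbox u v \<in> lmeasurable"
    using measurable_differentiable_image_eq[OF S der inj'] int by simp
  show "measure lebesgue (?G ` cbox u v) = integral (cbox u v) (\<lambda>x. (cmod (deriv F (complex_of_vec x)))\<^sup>2)"
    using measure_differentiable_image_eq[OF S der inj' int] by (simp add: det_conjugate_vec)
qed

lemma mem_cbox_vec2: "x \<in> cbox u v \<longleftrightarrow> u$1 \<le> x$1 \<and> x$1 \<le> v$1 \<and> u$2 \<le> x$2 \<and> x$2 \<le> v$2" for x :: "real^2"
  by (auto simp: mem_box_cart forall_2)

lemma content_cbox_vec2: 
  fixes u v :: "real^2"
  assumes "u$1 \<le> v$1" "u$2 \<le> v$2"
  shows "measure lborel (cbox u v) = (v$1 - u$1) * (v$2 - u$2)"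
  using content_cbox_cart[of u v] assms mem_cbox_vec2[of u u v] by (auto simp: UNIV_2)

text \<open>Fubini on \<open>real \<times> real\<close>, transported by the bijection
  \<open>P\<close> with inverse \<open>Q\<close>, which maps rectangles to rectangles of the same
  area.\<close>

lemma integral_cbox_vec2:
  fixes u v :: "real^2" and h :: "complex \<Rightarrow> real"
  assumes cont: "continuous_on (complex_of_vec ` cbox u v) h"
  shows "integral (cbox u v) (\<lambda>x. h (complex_of_vec x)) =
           integral {u$1..v$1} (\<lambda>x. integral {u$2..v$2} (\<lambda>y. h (Complex x y)))"
proof -
  define P :: "real \<times> real \<Rightarrow> real^2" where "P = (\<lambda>p. vector [fst p, snd p])"
  define Q :: "real^2 \<Rightarrow> real \<times> real" where "Q = (\<lambda>v. (v$1, v$2))"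
  have PQ: "P (Q x) = x" "Q (P y) = y" for x y
    by (auto simp: P_def Q_def vec_eq_iff forall_2)
  have P: "P ` cbox a b = cbox (P a) (P b)" for a b
  proof (intro equalityI subsetI)
    fix x assume "x \<in> cbox (P a) (P b)"
    hence "Q x \<in> cbox a b" 
      by (cases a; cases b) (auto simp: mem_cbox_vec2 P_def Q_def cbox_Pair_eq)
    thus "x \<in> P ` cbox a b" using PQ(1)[of x] by (metis imageI)
  qed (cases a; cases b, auto simp: mem_cbox_vec2 P_def cbox_Pair_eq)
  have Q: "Q ` cbox a b = cbox (Q a) (Q b)" for a b
    using P[of "Q a" "Q b"] by (metis (no_types, lifting) PQ image_image image_cong image_ident)
  have lP: "bounded_linear P"
    by (rule linear_conv_bounded_linear[THEN iffD1], rule linearI)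
       (simp_all add: P_def vec_eq_iff forall_2)
  let ?f = "\<lambda>x. h (complex_of_vec x)"
  have contf: "continuous_on (cbox u v) ?f"
    by (rule continuous_on_compose2[OF cont linear_continuous_on[OF bounded_linear_complex_of_vec]]) auto
  have fP: "?f (P p) = h (Complex (fst p) (snd p))" for p by (simp add: P_def complex_of_vec_def)
  have con: "measure lborel (P ` cbox a b) = 1 * measure lborel (cbox a b)" for a b
  proof (cases "cbox a b = {}")
    case False
    obtain a1 a2 b1 b2 where [simp]: "a = (a1,a2)" "b = (b1,b2)" by (cases a; cases b)
    have "a1 \<le> b1" "a2 \<le> b2" using False by (auto simp: cbox_Pair_eq)
    thus ?thesis unfolding P by (subst content_cbox_vec2) (auto simp: P_def content_Pair)
  qed simp
  have "(?f has_integral integral (cbox u v) ?f) (cbox u v)"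
    using contf by (simp add: integrable_continuous integrable_integral)
  hence "((\<lambda>x. ?f (P x)) has_integral (1 / 1) *\<^sub>R integral (cbox u v) ?f) (Q ` cbox u v)"
    by (intro has_integral_twiddle[of 1 Q P, OF _ PQ(2) PQ(1) linear_continuous_at[OF lP] _ _ con]) 
       (use P Q in \<open>(blast | simp)+\<close>)
  hence "((\<lambda>x. ?f (P x)) has_integral integral (cbox u v) ?f) (Q ` cbox u v)" by simp
  hence 1: "integral (cbox (u$1, u$2) (v$1, v$2)) (\<lambda>x. ?f (P x)) = integral (cbox u v) ?f"
    unfolding Q by (intro integral_unique) (simp add: Q_def)
  have "continuous_on (cbox (u$1, u$2) (v$1, v$2)) (\<lambda>x. ?f (P x))"
    by (rule continuous_on_compose2[OF contf linear_continuous_on[OF lP]]) 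
      (use P[of "(u$1, u$2)" "(v$1, v$2)"] PQ(1)[of u] PQ(1)[of v] in \<open>auto simp: Q_def\<close>)
  from integral_prod_continuous[OF this] 1 show ?thesis by (simp add: fP)
qed

text \<open>The integrand is bounded below by \<open>2 Re F' - 1\<close>, whose integral over every vertical
  segment is determined by the increment of \<open>F\<close>.\<close>

lemma integral_deriv_ge_area:
  fixes a b T :: real
  assumes S: "open S" "F holomorphic_on S" and ab: "a \<le> b" "0 \<le> T"
    and sub: "\<And>x y. x \<in> {a..b} \<Longrightarrow> y \<in> {0..T} \<Longrightarrow> Complex x y \<in> S"
    and per: "\<And>x. x \<in> {a..b} \<Longrightarrow> F (Complex x T) = F (Complex x 0) + \<i> * T"
  shows "(b - a) * T \<le> integral (cbox (vector [a, 0]) (vector [b, T])) (\<lambda>x. (cmod (deriv F (complex_of_vec x)))\<^sup>2)"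
proof -
  let ?u = "vector [a, 0] :: real^2" and ?v = "vector [b, T] :: real^2"
  have img: "complex_of_vec ` cbox ?u ?v \<subseteq> S"
    using sub by (auto simp: mem_cbox_vec2 complex_of_vec_def)
  have cont: "continuous_on (complex_of_vec ` cbox ?u ?v) (deriv F)"
    by (rule continuous_on_subset[OF holomorphic_on_imp_continuous_on[OF holomorphic_deriv[OF S(2,1)]] img])
  have cont': "continuous_on (cbox ?u ?v) (\<lambda>x. deriv F (complex_of_vec x))"
    by (rule continuous_on_compose2[OF cont linear_continuous_on[OF bounded_linear_complex_of_vec]]) auto
  let ?h = "\<lambda>z. 2 * Re (deriv F z) - 1"
  have "integral (cbox ?u ?v) (\<lambda>x. ?h (complex_of_vec x)) =
          integral {a..b} (\<lambda>x. integral {0..T} (\<lambda>y. ?h (Complex x y)))"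
    by (subst integral_cbox_vec2) (auto intro!: continuous_intros cont)
  also have "\<dots> = integral {a..b} (\<lambda>x. T)"
  proof (rule integral_cong)
    fix x assume x: "x \<in> {a..b}"
    have "((\<lambda>y. ?h (Complex x y)) has_integral (2 * Im (F (Complex x T)) - T) - (2 * Im (F (Complex x 0)) - 0)) {0..T}"
    proof (rule fundamental_theorem_of_calculus[OF ab(2)])
      fix y assume y: "y \<in> {0..T}"
      have "(F has_field_derivative deriv F (Complex x y)) (at (Complex x y))"
        using S sub[OF x y] by (intro holomorphic_derivI) auto
      moreover have "((\<lambda>y. Complex x y) has_vector_derivative \<i>) (at y within {0..T})"
        unfolding Complex_eq by (auto intro!: derivative_eq_intros)
      ultimately have "((\<lambda>y. F (Complex x y)) has_vector_derivative (\<i> * deriv F (Complex x y))) (at y within {0..T})"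
        using field_vector_diff_chain_within[of "\<lambda>y. Complex x y" \<i> y "{0..T}" F "deriv F (Complex x y)"]
        by (auto simp: o_def intro: has_field_derivative_at_within)
      from bounded_linear.has_vector_derivative[OF bounded_linear_Im this]
      have "((\<lambda>y. Im (F (Complex x y))) has_real_derivative Re (deriv F (Complex x y))) (at y within {0..T})"
        by (simp add: has_real_derivative_iff_has_vector_derivative)
      from DERIV_diff[OF DERIV_cmult[OF this, of 2] DERIV_ident]
      show "((\<lambda>y. 2 * Im (F (Complex x y)) - y) has_vector_derivative ?h (Complex x y)) (at y within {0..T})"
        by (simp add: has_real_derivative_iff_has_vector_derivative)
    qed
    thus "integral {0..T} (\<lambda>y. ?h (Complex x y)) = T"
      using per[OF x] by (auto dest!: integral_unique)
  qed
  also have "\<dots> = (b - a) * T" using ab by simp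
  finally have "(b - a) * T = integral (cbox ?u ?v) (\<lambda>x. ?h (complex_of_vec x))" ..
  also have "\<dots> \<le> integral (cbox ?u ?v) (\<lambda>x. (cmod (deriv F (complex_of_vec x)))\<^sup>2)"
  proof (rule integral_le)
    show "?h (complex_of_vec x) \<le> (cmod (deriv F (complex_of_vec x)))\<^sup>2" for x
    proof -
      \<comment> \<open>This is |F' - 1|^2 \<ge> 0.\<close>
      have "0 \<le> (Re (deriv F (complex_of_vec x)) - 1)\<^sup>2 + (Im (deriv F (complex_of_vec x)))\<^sup>2" by simp
      thus ?thesis unfolding cmod_power2 by (simp add: power2_eq_square algebra_simps)
    qed
  qed (intro integrable_continuous continuous_intros cont')+
  finally show ?thesis .
qed

subsection \<open>Univalent functions\<close>

text \<open>In the coordinate \<open>\<xi> = ln z\<close> the map \<open>F\<close> becomes a univalent map \<open>\<Lambda>\<close> of the left half-plane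
  that commutes with translation by \<open>2 \<pi> \<i>\<close>. The images of a long rectangle under \<open>\<Lambda>\<close> and
  under a translate of \<open>- \<Lambda>\<close> are disjoint, and comparing areas bounds \<open>F'(0)\<close>.\<close>

lemma Bieberbach_Eilenberg_univalent:
  assumes hol: "F holomorphic_on ball 0 1" and inj: "inj_on F (ball 0 1)" and F0: "F 0 = 0"
    and prod_ne_1: "\<And>x y. x \<in> ball 0 1 \<Longrightarrow> y \<in> ball 0 1 \<Longrightarrow> F x * F y \<noteq> 1"
  shows "cmod (deriv F 0) \<le> 1"
proof (rule ccontr)
  assume "\<not> cmod (deriv F 0) \<le> 1"
  then obtain c where c: "1 < c" "c < cmod (deriv F 0)" using dense[of 1 "cmod (deriv F 0)"] by auto
  \<comment> \<open>The choice t > 1 / c makes ln t - ln r larger than - ln (c r) for every r > 0;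
    this is the strict inequality \<open>Y < b - a\<close> that yields the contradiction.\<close>
  obtain t where t: "1 / c < t" "t < 1" using dense[of "1/c" 1] c by auto
  have t0: "t > 0" using t c by (meson less_trans zero_less_divide_1_iff zero_less_one)
  have F_ne_0: "F z \<noteq> 0" if "z \<in> ball 0 1" "z \<noteq> 0" for z
    using inj_onD[OF inj, of z 0] that F0 by auto
  obtain h where h: "h holomorphic_on ball 0 1" "\<And>z. norm z < 1 \<Longrightarrow> F z = z * h z" "deriv F 0 = h 0"
    using Schwarz3[OF hol F0] by blast
  have h_ne_0: "h z \<noteq> 0" if "z \<in> ball 0 1" for z
    using F_ne_0[OF that] h(2)[of z] h(3) that c by (cases "z = 0") auto
  obtain l where l: "l holomorphic_on ball 0 1" "\<And>z. z \<in> ball 0 1 \<Longrightarrow> h z = exp (l z)"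
    using contractible_imp_holomorphic_log[OF h(1) convex_imp_contractible[OF convex_ball]] h_ne_0
    by metis

  have "isCont h 0" using holomorphic_on_imp_continuous_on[OF h(1)] by (simp add: continuous_on_eq_continuous_at)
  hence "((\<lambda>z. cmod (h z)) \<longlongrightarrow> cmod (h 0)) (at 0)" unfolding isCont_def by (intro tendsto_intros)
  hence "eventually (\<lambda>z. cmod (h z) > c) (at 0)" using c h(3) by (auto dest: order_tendstoD)
  then obtain e where e: "e > 0" "\<And>z. z \<noteq> 0 \<Longrightarrow> cmod z < e \<Longrightarrow> cmod (h z) > c"
    by (auto simp: eventually_at)
  obtain r where r: "0 < r" "r < e" "r < t" "r < 1 / c"
    using dense[of 0 "min (min e t) (1 / c)"] e(1) t0 c by auto
  have sub: "cball 0 r \<subseteq> ball (0::complex) 1" using r t by auto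
  \<comment> \<open>On |z| = r the values of F have modulus at least c r, so the image of the small
    disc covers the disc of radius c r. By injectivity F is large off the small disc
    (\<open>F_large\<close>). Values beyond 1 / (c r) are excluded because their inverses would be
    covered too (\<open>F_small\<close>).\<close>
  have "ball (F 0) (c * r) \<subseteq> F ` ball 0 r"
  proof (rule ball_subset_open_map_image)
    show "continuous_on (closure (ball 0 r)) F"
      using r by (simp add: continuous_on_subset[OF holomorphic_on_imp_continuous_on[OF hol] sub])
    show "open (F ` interior (ball 0 r))"
      using r sub by (auto intro!: open_mapping_thm3 holomorphic_on_subset[OF hol] inj_on_subset[OF inj])
    show "c * r \<le> norm (F x - F 0)" if "x \<in> frontier (ball 0 r)" for x
    proof -
      have "cmod x = r" using that r by simp
      moreover from this have "c < cmod (h x)" using r by (intro e) auto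
      ultimately show ?thesis using h(2)[of x] r t F0 by (simp add: norm_mult)
    qed
  qed (use r c in auto)
  hence cover: "\<exists>x\<in>ball 0 r. F x = y" if "cmod y < c * r" for y
    using that F0 by (auto simp: subset_iff image_iff)
  have F_large: "c * r \<le> cmod (F z)" if "z \<in> ball 0 1" "r \<le> cmod z" for z
  proof (rule ccontr)
    assume "\<not> c * r \<le> cmod (F z)"
    then obtain x where x: "x \<in> ball 0 r" "F x = F z" using cover[of "F z"] by auto
    hence "x = z" using inj_onD[OF inj, of x z] that sub by auto
    thus False using x that by simp
  qed
  have F_small: "cmod (F z) \<le> 1 / (c * r)" if "z \<in> ball 0 1" for z
  proof (rule ccontr)
    assume gt: "\<not> cmod (F z) \<le> 1 / (c * r)"
    have Fz: "F z \<noteq> 0" using gt r c by auto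
    have "cmod (1 / F z) < c * r" using gt r c Fz by (simp add: norm_divide field_simps)
    then obtain x where x: "x \<in> ball 0 r" "F x = 1 / F z" using cover by blast
    moreover have "x \<in> ball 0 1" using x(1) r t by auto
    ultimately show False using prod_ne_1[of z x] that x(2) Fz by simp
  qed

  define S where "S = {\<xi>. Re \<xi> < 0}"
  have S: "open S" unfolding S_def by (rule open_halfspace_Re_lt)
  have exp_S: "exp \<xi> \<in> ball 0 1" if "\<xi> \<in> S" for \<xi> using that by (simp add: S_def)
  define \<Lambda> where "\<Lambda> = (\<lambda>\<xi>. \<xi> + l (exp \<xi>))"
  have \<Lambda>_hol: "\<Lambda> holomorphic_on S" unfolding \<Lambda>_def
    by (intro holomorphic_intros holomorphic_on_compose_gen[OF _ l(1), unfolded o_def]) (use exp_S in auto)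
  have exp_\<Lambda>: "exp (\<Lambda> \<xi>) = F (exp \<xi>)" if "\<xi> \<in> S" for \<xi>
    using exp_S[OF that] h(2)[of "exp \<xi>"] l(2)[of "exp \<xi>"] by (simp add: \<Lambda>_def exp_add)
  have \<Lambda>_inj: "inj_on \<Lambda> S"
  proof (rule inj_onI)
    fix x y assume xy: "x \<in> S" "y \<in> S" "\<Lambda> x = \<Lambda> y"
    hence "F (exp x) = F (exp y)" using exp_\<Lambda> by metis
    hence "exp x = exp y" using inj exp_S xy by (auto dest: inj_onD)
    thus "x = y" using xy(3) by (simp add: \<Lambda>_def)
  qed

  \<comment> \<open>The right edge of the rectangle stays at |z| = t < 1 because l may be unbounded
    on the whole disc. \<open>B\<close> bounds how far the images overhang the rectangle
    vertically.\<close>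
  have "compact (l ` cball 0 t)"
    using t by (intro compact_continuous_image continuous_on_subset[OF holomorphic_on_imp_continuous_on[OF l(1)]]) auto
  then obtain B where B: "B > 0" "\<And>z. cmod z \<le> t \<Longrightarrow> cmod (l z) \<le> B"
    by (auto dest!: compact_imp_bounded simp: bounded_pos)

  define a b Y where "a = ln r" "b = ln t" "Y = - ln (c * r)"
  have ab: "a < b" "b < 0" using r t t0 by (auto simp: a_b_Y_def)
  have cr: "0 < c * r" "c * r < 1" using r c by (simp_all add: pos_less_divide_eq mult.commute)
  have "ln (1 / c) < ln t" using t t0 c by (subst ln_less_cancel_iff) auto
  moreover have "ln (1 / c) = - ln c" "ln (c * r) = ln c + ln r"
    using c(1) r(1) by (simp_all add: ln_div ln_mult)
  ultimately have Y: "Y > 0" "Y < b - a"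
    unfolding a_b_Y_def using ln_less_zero[OF cr] by linarith+
  have Re_\<Lambda>: "\<bar>Re (\<Lambda> \<xi>)\<bar> \<le> Y" if "\<xi> \<in> S" "a \<le> Re \<xi>" for \<xi>
  proof -
    have "r \<le> cmod (exp \<xi>)" using that(2) r(1) by (simp add: a_b_Y_def) (metis exp_le_cancel_iff exp_ln)
    hence "c * r \<le> exp (Re (\<Lambda> \<xi>))" "exp (Re (\<Lambda> \<xi>)) \<le> 1 / (c * r)"
      using F_large[OF exp_S[OF that(1)]] F_small[OF exp_S[OF that(1)]]
      by (simp_all only: exp_\<Lambda>[OF that(1), symmetric] norm_exp_eq_Re)
    hence "ln (c * r) \<le> Re (\<Lambda> \<xi>)" "Re (\<Lambda> \<xi>) \<le> ln (1 / (c * r))"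
      using cr 
      by (metis ln_exp ln_le_cancel_iff exp_gt_zero, metis ln_exp ln_le_cancel_iff exp_gt_zero zero_less_divide_1_iff)
    moreover have "ln (1 / (c * r)) = - ln (c * r)" using cr r(1) c(1) by (simp add: ln_div)
    ultimately show ?thesis by (simp add: a_b_Y_def abs_le_iff)
  qed

  \<comment> \<open>With T = 2 \<pi> N the images under \<open>\<Lambda>\<close> and i T -
    \<open>\<Lambda>\<close> each have area at least (b - a) T. They are disjoint, since a common
    value would exponentiate to F x F y = 1, and both fit into a box of width 2 Y and height T + 2
    B. For large N this contradicts Y < b - a.\<close>
  have main: "(b - a) * (2 * pi * real N) \<le> Y * (2 * pi * real N + 2 * B)" for N :: nat
  proof -
    define T where "T = 2 * pi * real N"
    let ?u = "vector [a, 0] :: real^2" and ?v = "vector [b, T] :: real^2"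
    let ?M = "\<lambda>\<xi>. \<i> * T - \<Lambda> \<xi>"
    define img where "img = (\<lambda>G. (\<lambda>x. vec_of_complex (G (complex_of_vec x))) ` cbox ?u ?v)"
    have T0: "T \<ge> 0" by (simp add: T_def)
    have S_box: "complex_of_vec ` cbox ?u ?v \<subseteq> S"
      using ab by (auto simp: mem_cbox_vec2 complex_of_vec_def S_def)
    have inj1: "inj_on \<Lambda> (complex_of_vec ` cbox ?u ?v)"
      by (rule inj_on_subset[OF \<Lambda>_inj S_box])
    hence inj2: "inj_on ?M (complex_of_vec ` cbox ?u ?v)"
      by (auto simp: inj_on_def)
    have M_hol: "?M holomorphic_on S" by (intro holomorphic_intros \<Lambda>_hol)
    have deriv_M: "deriv ?M \<xi> = - deriv \<Lambda> \<xi>" if "\<xi> \<in> S" for \<xi>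
      by (rule DERIV_imp_deriv) (auto intro!: derivative_eq_intros holomorphic_derivI[OF \<Lambda>_hol S that])
    have *: "(b - a) * T \<le> integral (cbox ?u ?v) (\<lambda>x. (cmod (deriv \<Lambda> (complex_of_vec x)))\<^sup>2)"
    proof (rule integral_deriv_ge_area[OF S \<Lambda>_hol _ T0])
      fix x assume "x \<in> {a..b}"
      have "exp (Complex x T) = exp (Complex x 0 + of_nat N * (2 * of_real pi * \<i>))"
        by (simp add: T_def Complex_eq algebra_simps)
      also have "\<dots> = exp (Complex x 0)"
        by (simp add: exp_add exp_of_nat_mult)
      finally show "\<Lambda> (Complex x T) = \<Lambda> (Complex x 0) + \<i> * T"
        by (simp add: \<Lambda>_def Complex_eq)
    qed (use ab in \<open>auto simp: S_def\<close>)
    have m1: "img \<Lambda> \<in> lmeasurable" "(b - a) * T \<le> measure lebesgue (img \<Lambda>)"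
      using measure_holomorphic_image[OF S \<Lambda>_hol S_box inj1] * by (auto simp: img_def)
    have "integral (cbox ?u ?v) (\<lambda>x. (cmod (deriv ?M (complex_of_vec x)))\<^sup>2) =
          integral (cbox ?u ?v) (\<lambda>x. (cmod (deriv \<Lambda> (complex_of_vec x)))\<^sup>2)"
      using S_box by (intro integral_cong) (subst deriv_M, auto)
    hence m2: "img ?M \<in> lmeasurable" "(b - a) * T \<le> measure lebesgue (img ?M)"
      using measure_holomorphic_image[OF S M_hol S_box inj2] * by (auto simp: img_def)
    have disj: "img \<Lambda> \<inter> img ?M = {}"
    proof -
      have "\<Lambda> x \<noteq> ?M y" if "x \<in> S" "y \<in> S" for x y
      proof
        assume "\<Lambda> x = ?M y"
        hence "exp (\<Lambda> x + \<Lambda> y) = exp (of_nat N * (2 * of_real pi * \<i>))"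
          by (simp add: T_def algebra_simps)
        also have "\<dots> = 1" by (simp add: exp_of_nat_mult)
        finally show False using prod_ne_1[OF exp_S exp_S, OF that] exp_\<Lambda> that by (simp add: exp_add)
      qed
      hence "vec_of_complex (\<Lambda> x) \<noteq> vec_of_complex (?M y)" if "x \<in> S" "y \<in> S" for x y
        using that by (metis vec_of_complex_inverse)
      thus ?thesis using S_box unfolding img_def by blast
    qed
    let ?C = "cbox (vector [- Y, - B]) (vector [Y, T + B]) :: (real^2) set"
    have sub: "img \<Lambda> \<union> img ?M \<subseteq> ?C"
    proof -
      have "vec_of_complex (\<Lambda> \<xi>) \<in> ?C \<and> vec_of_complex (?M \<xi>) \<in> ?C"
        if "\<xi> \<in> complex_of_vec ` cbox ?u ?v" for \<xi>
      proof -
        have \<xi>: "\<xi> \<in> S" "a \<le> Re \<xi>" "Re \<xi> \<le> b" "0 \<le> Im \<xi>" "Im \<xi> \<le> T"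
          using that S_box by (auto simp: mem_cbox_vec2 complex_of_vec_def)
        have "cmod (exp \<xi>) \<le> t" using \<xi>(3) t0 by (simp add: a_b_Y_def) (metis exp_le_cancel_iff exp_ln)
        hence "\<bar>Im (l (exp \<xi>))\<bar> \<le> B" using B(2) abs_Im_le_cmod order_trans by blast
        hence "- B \<le> Im (\<Lambda> \<xi>)" "Im (\<Lambda> \<xi>) \<le> T + B" using \<xi> by (simp_all add: \<Lambda>_def)
        thus ?thesis using Re_\<Lambda>[OF \<xi>(1,2)] by (auto simp: mem_cbox_vec2 abs_le_iff)
      qed
      thus ?thesis unfolding img_def by blast
    qed
    have "2 * ((b - a) * T) \<le> measure lebesgue (img \<Lambda>) + measure lebesgue (img ?M)"
      using m1 m2 by simp
    also have "\<dots> = measure lebesgue (img \<Lambda> \<union> img ?M)"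
      using measure_Un3[OF m1(1) m2(1)] disj by simp
    also have "\<dots> \<le> measure lebesgue ?C"
      using sub m1 m2 by (intro measure_mono_fmeasurable) auto
    also have "\<dots> = 2 * Y * (T + 2 * B)"
      using Y B(1) T0 by (simp add: measure_completion content_cbox_vec2)
    finally have "(b - a) * T \<le> Y * (T + 2 * B)" by (simp add: algebra_simps)
    thus ?thesis by (simp only: T_def)
  qed
  have "2 * pi * (b - a - Y) > 0" using Y(2) by simp
  then obtain N where N: "real N * (2 * pi * (b - a - Y)) > 2 * B * Y"
    using reals_Archimedean3 by blast
  show False using main[of N] N by (simp add: algebra_simps)
qed

text \<open>With \<open>q = exp ((L - L 0) / 2)\<close> the map \<open>(q - 1) / (q + 1)\<close> is a univalent
  Bieberbach--Eilenberg function.\<close>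

lemma Koebe_quarter_log:
  assumes hol: "L holomorphic_on ball 0 1" and inj: "inj_on (\<lambda>z. exp (L z)) (ball 0 1)"
  shows "cmod (deriv L 0) \<le> 4"
proof -
  define q where "q = (\<lambda>z. exp ((L z - L 0) / 2))"
  have q_sq: "exp (L 0) * (q z)\<^sup>2 = exp (L z)" for z
    by (simp add: q_def power2_eq_square flip: exp_add)
  have q_hol: "q holomorphic_on ball 0 1" unfolding q_def by (intro holomorphic_intros hol) auto
  have q0: "q 0 = 1" by (simp add: q_def)
  have q_eq: "x = y" if "x \<in> ball 0 1" "y \<in> ball 0 1" "(q x)\<^sup>2 = (q y)\<^sup>2" for x y
    using inj_onD[OF inj _ that(1,2)] that(3) by (metis q_sq)
  \<comment> \<open>\<open>q\<close> is a zero-free square root of an injective function, so it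
    never takes two opposite values. The equation F x F y = 1 reduces exactly to q x + q y =
    0.\<close>
  have q_add: "q x + q y \<noteq> 0" if "x \<in> ball 0 1" "y \<in> ball 0 1" for x y
  proof
    assume *: "q x + q y = 0"
    hence "q x = - q y" by (simp add: eq_neg_iff_add_eq_0)
    hence "x = y" using q_eq[OF that] by simp
    thus False using * by (simp add: q_def)
  qed
  have q_ne: "q x + 1 \<noteq> 0" if "x \<in> ball 0 1" for x using q_add[OF that, of 0] q0 by simp
  define F where "F = (\<lambda>z. (q z - 1) / (q z + 1))"
  have F_hol: "F holomorphic_on ball 0 1" unfolding F_def by (intro holomorphic_intros q_hol q_ne)
  have "cmod (deriv F 0) \<le> 1"
  proof (rule Bieberbach_Eilenberg_univalent[OF F_hol])
    show "inj_on F (ball 0 1)"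
    proof (rule inj_onI)
      fix x y assume xy: "x \<in> ball 0 1" "y \<in> ball 0 1" "F x = F y"
      hence "(q x - 1) * (q y + 1) = (q y - 1) * (q x + 1)"
        using q_ne[OF xy(1)] q_ne[OF xy(2)] by (simp add: F_def frac_eq_eq)
      hence "q x = q y" by (simp add: algebra_simps)
      thus "x = y" using q_eq xy by simp
    qed
    show "F 0 = 0" by (simp add: F_def q0)
    show "F x * F y \<noteq> 1" if "x \<in> ball 0 1" "y \<in> ball 0 1" for x y
    proof
      assume "F x * F y = 1"
      hence "(q x - 1) * (q y - 1) = (q x + 1) * (q y + 1)"
        using q_ne[OF that(1)] q_ne[OF that(2)] by (simp add: F_def)
      hence "2 * (q x + q y) = 0" by (simp add: algebra_simps)
      hence "q x + q y = 0" by (metis mult_eq_0_iff zero_neq_numeral)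
      thus False using q_add[OF that] by simp
    qed
  qed
  moreover have "deriv F 0 = deriv L 0 / 4"
  proof (rule DERIV_imp_deriv)
    have "(L has_field_derivative deriv L 0) (at 0)" by (rule holomorphic_derivI[OF hol]) auto
    hence "(q has_field_derivative deriv L 0 / 2) (at 0)"
      unfolding q_def by (auto intro!: derivative_eq_intros)
    thus "(F has_field_derivative deriv L 0 / 4) (at 0)"
      unfolding F_def using q0 by (auto intro!: derivative_eq_intros)
  qed
  ultimately show ?thesis by (simp add: norm_divide)
qed

text \<open>Precompose with the disc automorphism taking 0 to w; its derivative at 0 is 1 -
  |w|^2.\<close>

lemma Koebe_quarter_log_at:
  assumes hol: "L holomorphic_on ball 0 1" and inj: "inj_on (\<lambda>z. exp (L z)) (ball 0 1)"
    and w: "cmod w < 1"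
  shows "cmod (deriv L w) \<le> 4 / (1 - (cmod w)\<^sup>2)"
proof -
  define M where "M = Moebius_function 0 (- w)"
  have M: "M x \<in> ball 0 1" if "x \<in> ball 0 1" for x
    using Moebius_function_norm_lt_1[of "- w" x 0] w that by (simp add: M_def)
  have M_hol: "M holomorphic_on ball 0 1"
    unfolding M_def by (rule Moebius_function_holomorphic) (use w in simp)
  have M_inj: "inj_on M (ball 0 1)"
    by (rule inj_on_inverseI[of _ "Moebius_function 0 w"])
       (auto simp: M_def intro!: Moebius_function_compose w)
  have hol': "(\<lambda>x. L (M x)) holomorphic_on ball 0 1"
    by (rule holomorphic_on_compose_gen[OF M_hol hol, unfolded o_def]) (use M in blast)
  have inj': "inj_on (\<lambda>x. exp (L (M x))) (ball 0 1)"
    using comp_inj_on[OF M_inj inj_on_subset[OF inj]] M by (force simp: o_def)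
  have M0: "M 0 = w" by (simp add: M_def Moebius_function_def)
  have pos: "1 - (cmod w)\<^sup>2 > 0" using w by (simp add: abs_square_less_1)
  have eq: "1 - cnj w * w = of_real (1 - (cmod w)\<^sup>2)"
    by (simp only: mult.commute[of "cnj w"] complex_norm_square[symmetric] of_real_diff of_real_1 of_real_power)
  have nz: "1 - cnj w * w \<noteq> 0" using pos unfolding eq by (simp only: of_real_eq_0_iff)
  have dM: "(M has_field_derivative (1 - cnj w * w)) (at 0)"
    unfolding M_def Moebius_function_def by (auto intro!: derivative_eq_intros)
  have "(L has_field_derivative deriv L w) (at (M 0))"
    unfolding M0 by (rule holomorphic_derivI[OF hol]) (use w in auto)
  from DERIV_chain2[OF this dM]
  have "deriv (\<lambda>x. L (M x)) 0 = deriv L w * (1 - cnj w * w)" by (rule DERIV_imp_deriv)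
  with Koebe_quarter_log[OF hol' inj'] have "cmod (deriv L w) * \<bar>1 - (cmod w)\<^sup>2\<bar> \<le> 4"
    unfolding eq by (simp add: norm_mult del: of_real_diff)
  thus ?thesis using pos by (simp add: pos_le_divide_eq)
qed

text \<open>Termwise comparison of the exponential series without their constant terms.\<close>

lemma norm_exp_minus_1_le: "norm (exp z - 1) \<le> exp (norm z) - 1" for z :: complex
proof -
  have "norm (exp z - 1) = norm (\<Sum>n. (1 / fact (Suc n)) *\<^sub>R z ^ Suc n)"
    using suminf_split_head[OF summable_exp_generic[of z]] by (simp add: exp_def divide_inverse)
  also have "\<dots> \<le> (\<Sum>n. norm ((1 / fact (Suc n)) *\<^sub>R z ^ Suc n))"
    using summable_Suc_iff[THEN iffD2, OF summable_norm_exp[of z]] 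
    by (intro summable_norm) (simp add: divide_inverse)
  also have "\<dots> = exp (norm z) - 1"
    using suminf_split_head[OF summable_exp_generic[of "norm z"]]
    by (simp add: exp_def divide_inverse norm_power norm_mult)
  finally show ?thesis .
qed

text \<open>Let L be a logarithm of g (R x) - b. Integrating |L'| \<le> 4 / (1 - x^2) along a radius
  bounds |L - L 0| by 2 ln ((1 + s) / (1 - s)). Exponentiating gives the factor ((1 + s) / (1 -
  s))^2 - 1 = 4 s / (1 - s)^2.\<close>

lemma Koebe_growth_omitted:
  assumes R: "R > 0" and hol: "g holomorphic_on ball 0 R" and inj: "inj_on g (ball 0 R)"
    and b: "b \<notin> g ` ball 0 R"
    and w: "cmod w < R" and s: "s = cmod w / R"
  shows "cmod (g w - g 0) \<le> 4 * s / (1 - s)\<^sup>2 * cmod (g 0 - b)"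
proof (cases "w = 0")
  case False
  define k where "k = (\<lambda>x. g (of_real R * x) - b)"
  have in_ball: "of_real R * x \<in> ball 0 R" if "x \<in> ball 0 1" for x :: complex
    using that R by (simp add: norm_mult)
  have k_hol: "k holomorphic_on ball 0 1" unfolding k_def
    by (intro holomorphic_intros holomorphic_on_compose_gen[OF _ hol, unfolded o_def]) (use in_ball in blast)
  have k_ne_0: "k x \<noteq> 0" if "x \<in> ball 0 1" for x
    using b imageI[OF in_ball[OF that], of g] by (auto simp: k_def)
  obtain L where l: "L holomorphic_on ball 0 1" "\<And>x. x \<in> ball 0 1 \<Longrightarrow> k x = exp (L x)"
    using contractible_imp_holomorphic_log[OF k_hol convex_imp_contractible[OF convex_ball] k_ne_0] by blast
  have "inj_on (\<lambda>x. exp (L x)) (ball 0 1)"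
  proof (rule inj_onI)
    fix x y :: complex assume xy: "x \<in> ball 0 1" "y \<in> ball 0 1" "exp (L x) = exp (L y)"
    hence "k x = k y" using l(2) by metis
    hence "g (of_real R * x) = g (of_real R * y)" by (simp add: k_def)
    thus "x = y" using inj_onD[OF inj _ in_ball in_ball] xy R by auto
  qed
  note deriv_le = Koebe_quarter_log_at[OF l(1) this]
  have s01: "0 < s" "s < 1" using False w R by (auto simp: s)
  define u where "u = w / of_real (cmod w)"
  have u: "cmod u = 1" using False by (simp add: u_def norm_divide)
  define \<phi> where "\<phi> = (\<lambda>x::real. 2 * (ln (1 + x) - ln (1 - x)))"
  have "cmod (L (of_real s * u) - L (of_real 0 * u)) \<le> \<phi> s - \<phi> 0"
  proof (rule differentiable_bound_general[OF s01(1)])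
    have "continuous_on {0..s} (\<lambda>x. L (of_real x * u))"
      by (rule continuous_on_compose2[OF holomorphic_on_imp_continuous_on[OF l(1)]])
         (use s01 u in \<open>auto intro!: continuous_intros simp: norm_mult\<close>)
    thus "continuous_on {0..s} (\<lambda>x. L (of_real x * u))" .
    show "continuous_on {0..s} \<phi>" unfolding \<phi>_def
      using s01 by (intro continuous_intros) auto
    fix x assume x: "0 < x" "x < s"
    have xu: "cmod (of_real x * u) = x" using x u by (simp add: norm_mult)
    have "(L has_field_derivative deriv L (of_real x * u)) (at (of_real x * u))"
      by (rule holomorphic_derivI[OF l(1)]) (use x s01 xu in auto)
    moreover have "((\<lambda>x. of_real x * u) has_vector_derivative u) (at x)"
      by (auto intro!: derivative_eq_intros)
    ultimately show "((\<lambda>x. L (of_real x * u)) has_vector_derivative u * deriv L (of_real x * u)) (at x)"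
      using field_vector_diff_chain_at[of "\<lambda>x. of_real x * u" u x L] by (simp add: o_def)
    show "(\<phi> has_vector_derivative 4 / (1 - x\<^sup>2)) (at x)"
    proof -
      have "2 * (1 / (1 + x) + 1 / (1 - x)) = 4 / (1 - x\<^sup>2)"
        using x s01 by (simp add: add_frac_eq power2_eq_square algebra_simps)
      moreover have "(\<phi> has_real_derivative 2 * (1 / (1 + x) + 1 / (1 - x))) (at x)"
        unfolding \<phi>_def using x s01 by (auto intro!: derivative_eq_intros)
      ultimately have "(\<phi> has_real_derivative 4 / (1 - x\<^sup>2)) (at x)" by simp
      thus ?thesis by (simp add: has_real_derivative_iff_has_vector_derivative)
    qed
    show "cmod (u * deriv L (of_real x * u)) \<le> 4 / (1 - x\<^sup>2)"
      using deriv_le[of "of_real x * u"] x s01 u unfolding xu by (simp add: norm_mult)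
  qed
  hence le: "cmod (L (of_real s * u) - L 0) \<le> 2 * ln ((1 + s) / (1 - s))"
    using s01 by (simp add: \<phi>_def ln_div)
  have "of_real R * (of_real s * u) = w" using False R by (simp add: s u_def)
  hence "g w - g 0 = k (of_real s * u) - k 0" by (simp add: k_def)
  also have "\<dots> = exp (L (of_real s * u)) - exp (L 0)"
    using l(2)[of "of_real s * u"] l(2)[of 0] s01 u by (simp add: norm_mult)
  also have "\<dots> = k 0 * (exp (L (of_real s * u) - L 0) - 1)"
    using l(2)[of 0] by (simp add: exp_diff field_simps)
  finally have "cmod (g w - g 0) \<le> cmod (k 0) * (exp (cmod (L (of_real s * u) - L 0)) - 1)"
    using norm_exp_minus_1_le by (simp add: norm_mult mult_left_mono)
  also have "\<dots> \<le> cmod (k 0) * (exp (2 * ln ((1 + s) / (1 - s))) - 1)"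
    using le by (intro mult_left_mono) auto
  also have "exp (2 * ln ((1 + s) / (1 - s))) - 1 = ((1 + s) / (1 - s))\<^sup>2 - 1"
    using s01 by (simp add: exp_double)
  also have "\<dots> = 4 * s / (1 - s)\<^sup>2"
    using s01 by (simp add: power_divide divide_simps) (simp add: power2_eq_square algebra_simps)
  finally show ?thesis by (simp add: k_def mult.commute)
qed (simp add: s)

text \<open>The growth estimate divided by |w|, in the limit w to 0.\<close>

lemma Koebe_quarter:
  assumes R: "R > 0" and hol: "g holomorphic_on ball 0 R" and inj: "inj_on g (ball 0 R)"
    and b: "b \<notin> g ` ball 0 R"
  shows "R * cmod (deriv g 0) \<le> 4 * cmod (g 0 - b)"
proof -
  have "(g has_field_derivative deriv g 0) (at 0)"
    by (rule holomorphic_derivI[OF hol]) (use R in auto)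
  hence "((\<lambda>w. R * cmod ((g w - g 0) / w)) \<longlongrightarrow> R * cmod (deriv g 0)) (at 0)"
    by (auto simp: has_field_derivative_iff intro!: tendsto_intros)
  moreover have "((\<lambda>w. 4 / (1 - cmod w / R)\<^sup>2 * cmod (g 0 - b)) \<longlongrightarrow> 4 / (1 - cmod 0 / R)\<^sup>2 * cmod (g 0 - b)) (at 0)"
    by (intro tendsto_intros) (use R in auto)
  moreover have "eventually (\<lambda>w. R * cmod ((g w - g 0) / w) \<le> 4 / (1 - cmod w / R)\<^sup>2 * cmod (g 0 - b)) (at 0)"
  proof -
    have "R * cmod ((g w - g 0) / w) \<le> 4 / (1 - cmod w / R)\<^sup>2 * cmod (g 0 - b)" if "w \<noteq> 0" "cmod w < R" for w
    proof -
      have "cmod (g w - g 0) \<le> (cmod w / R) * (4 / (1 - cmod w / R)\<^sup>2 * cmod (g 0 - b))"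
        using Koebe_growth_omitted[OF R hol inj b that(2) refl] by (simp add: field_simps)
      thus ?thesis using that R by (simp add: norm_divide field_simps)
    qed
    thus ?thesis using R by (auto simp: eventually_at intro!: exI[of _ R])
  qed
  ultimately have "R * cmod (deriv g 0) \<le> 4 / (1 - cmod 0 / R)\<^sup>2 * cmod (g 0 - b)"
    by (intro tendsto_le[OF at_neq_bot])
  thus ?thesis by simp
qed

subsection \<open>The Newton flow outside the unit disc\<close>

text \<open>On a circle |v| = const < 1 the real part is least at v = - |v|. After clearing
  denominators the claim is (1 - |v|) (|v| + Re v) \<ge> 0.\<close>

lemma Re_inverse_one_minus_ge:
  fixes v :: complex
  assumes "cmod v < 1"
  shows "1 / (1 + cmod v) \<le> Re (1 / (1 - v))"
proof -
  have "0 \<le> (1 - cmod v) * (cmod v + Re v)"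
    using assms abs_Re_le_cmod[of v] by (intro mult_nonneg_nonneg) auto
  moreover have "(cmod v)\<^sup>2 = (Re v)\<^sup>2 + (Im v)\<^sup>2" by (rule cmod_power2)
  ultimately have "(1 - Re v)\<^sup>2 + (Im v)\<^sup>2 \<le> (1 - Re v) * (1 + cmod v)"
    by (simp add: power2_eq_square algebra_simps)
  moreover have "(1 - Re v)\<^sup>2 + (Im v)\<^sup>2 > 0"
    using assms abs_Re_le_cmod[of v] by (intro add_pos_nonneg) auto
  moreover have "1 + cmod v > 0" by (simp add: add_pos_nonneg)
  ultimately show ?thesis
    by (simp add: Re_divide pos_le_divide_eq pos_divide_le_eq)
qed

lemma norm_cis_diff_le: "cmod (cis a - cis b) \<le> \<bar>a - b\<bar>"
proof -
  have "norm (cis a - cis b) \<le> 1 * norm (a - b)"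
  proof (rule differentiable_bound[where S = UNIV])
    fix x :: real
    show "(cis has_derivative (\<lambda>h. h *\<^sub>R (\<i> * cis x))) (at x within UNIV)"
      by (rule has_derivative_cis[OF has_derivative_ident])
    show "onorm (\<lambda>h. h *\<^sub>R (\<i> * cis x)) \<le> 1"
      by (rule onorm_le) (simp add: norm_mult)
  qed auto
  thus ?thesis by simp
qed

section \<open>Polynomials with simple roots in the closed unit disc\<close>

locale disc_polynomial =
  fixes Z :: "complex set" and d :: nat and f :: "complex poly" and \<zeta> :: complex
  assumes fin: "finite Z" and card_Z: "card Z = d" and d2: "d \<ge> 2"
    and Z_le: "\<And>a. a \<in> Z \<Longrightarrow> cmod a \<le> 1"
    and f_eq: "f = (\<Prod>a\<in>Z. [:- a, 1:])" and \<zeta>: "\<zeta> \<in> Z"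
begin

lemma poly_f: "poly f z = (\<Prod>a\<in>Z. z - a)"
  by (simp add: f_eq poly_prod)

lemma poly_f_eq_0_iff: "poly f z = 0 \<longleftrightarrow> z \<in> Z"
  using fin by (auto simp: poly_f)

text \<open>Equal to f' / f off \<open>Z\<close>. At a root one summand is 1 / 0 = 0, so the sum is
  used only off \<open>Z\<close>.\<close>

definition logderiv :: "complex \<Rightarrow> complex" where
  "logderiv z = (\<Sum>a\<in>Z. 1 / (z - a))"

lemma poly_pderiv: "poly (pderiv f) z = (\<Sum>a\<in>Z. \<Prod>b\<in>Z - {a}. z - b)"
  by (simp add: f_eq pderiv_prod poly_sum poly_prod pderiv_pCons)

lemma poly_pderiv_eq:
  assumes "z \<notin> Z"
  shows "poly (pderiv f) z = poly f z * logderiv z"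
proof -
  have "(\<Prod>b\<in>Z - {a}. z - b) = poly f z * (1 / (z - a))" if "a \<in> Z" for a
    using that assms fin by (auto simp: poly_f prod.remove[of Z a])
  thus ?thesis unfolding poly_pderiv logderiv_def sum_distrib_left by (intro sum.cong) auto
qed

lemma pderiv_root_nonzero:
  assumes "a \<in> Z"
  shows "poly (pderiv f) a \<noteq> 0"
proof -
  have "(\<Sum>c\<in>Z. \<Prod>b\<in>Z - {c}. a - b) = (\<Sum>c\<in>{a}. \<Prod>b\<in>Z - {c}. a - b)"
    using fin assms by (intro sum.mono_neutral_right) (auto intro!: prod_zero)
  thus ?thesis using fin by (simp add: poly_pderiv)
qed

text \<open>Each summand z / (z - a) equals 1 / (1 - a / z) with |a / z| \<le> 1 / |z| < 1. The
  resulting bound exceeds d / 2.\<close>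

lemma Re_logderiv_ge:
  assumes "cmod z > 1"
  shows "d * cmod z / (1 + cmod z) \<le> Re (z * logderiv z)"
proof -
  have "cmod z / (1 + cmod z) \<le> Re (z / (z - a))" if "a \<in> Z" for a
  proof -
    have "cmod (a / z) < 1" using Z_le[OF that] assms by (auto simp: norm_divide divide_less_eq)
    note Re_inverse_one_minus_ge[OF this]
    moreover have "z \<noteq> 0" "z \<noteq> a" using Z_le[OF that] assms by auto
    hence "1 / (1 - a / z) = z / (z - a)" by (simp add: divide_simps)
    moreover have "cmod z / (1 + cmod z) \<le> 1 / (1 + cmod (a / z))"
      using Z_le[OF that] assms by (auto simp: norm_divide field_simps add_pos_nonneg)
    ultimately show ?thesis by simp
  qed
  hence "(\<Sum>a\<in>Z. cmod z / (1 + cmod z)) \<le> (\<Sum>a\<in>Z. Re (z / (z - a)))" by (rule sum_mono)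
  thus ?thesis by (simp add: card_Z logderiv_def sum_distrib_left)
qed

text \<open>Only f (g x) = x is demanded. This already makes g injective, and together with g 0 =
  \<zeta> it determines g (\<open>branch_unique\<close>).\<close>

definition branch :: "real \<Rightarrow> (complex \<Rightarrow> complex) \<Rightarrow> bool" where
  "branch R g \<longleftrightarrow> R > 0 \<and> g holomorphic_on ball 0 R \<and> g 0 = \<zeta> \<and> (\<forall>x\<in>ball 0 R. poly f (g x) = x)"

end

section \<open>An inverse branch along a ray from the origin\<close>

locale inverse_branch = disc_polynomial +
  fixes R :: real and g :: "complex \<Rightarrow> complex"
  assumes branch: "branch R g"
begin

lemma R: "R > 0" and g_hol: "g holomorphic_on ball 0 R" and g0: "g 0 = \<zeta>"
  and f_g: "cmod x < R \<Longrightarrow> poly f (g x) = x"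
  using branch by (auto simp: branch_def)

lemma g_inj: "inj_on g (ball 0 R)"
  by (rule inj_on_inverseI[of _ "poly f"]) (simp add: f_g)

lemma deriv_f_g:
  assumes "cmod x < R"
  shows "poly (pderiv f) (g x) * deriv g x = 1"
proof -
  have "(g has_field_derivative deriv g x) (at x)"
    by (rule holomorphic_derivI[OF g_hol]) (use assms in auto)
  from DERIV_chain2[OF poly_DERIV this]
  have "((\<lambda>x. poly f (g x)) has_field_derivative poly (pderiv f) (g x) * deriv g x) (at x)" .
  moreover have "((\<lambda>x. poly f (g x)) has_field_derivative 1) (at x)"
    by (rule has_field_derivative_transform_within_open[of "\<lambda>x. x" _ _ "ball 0 R"])
       (use assms f_g in auto)
  ultimately show ?thesis by (rule DERIV_unique)
qed

lemma deriv_g: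
  assumes "cmod x < R" "x \<noteq> 0"
  shows "deriv g x = 1 / (x * logderiv (g x))" "logderiv (g x) \<noteq> 0"
proof -
  have "g x \<notin> Z" using f_g[OF assms(1)] assms(2) poly_f_eq_0_iff by metis
  hence "x * logderiv (g x) * deriv g x = 1"
    using deriv_f_g[OF assms(1)] f_g[OF assms(1)] by (simp add: poly_pderiv_eq)
  moreover from this show "logderiv (g x) \<noteq> 0" by auto
  ultimately show "deriv g x = 1 / (x * logderiv (g x))"
    using assms(2) by (simp add: eq_divide_eq mult_ac)
qed

lemma norm_ray_less:
  assumes "cmod w < R" "t \<in> {0..1}"
  shows "cmod (of_real t * w) < R"
proof -
  have "t * cmod w \<le> 1 * cmod w" using assms by (intro mult_right_mono) auto
  thus ?thesis using assms by (simp add: norm_mult)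
qed

text \<open>The curve t \<mapsto> g (t w) runs along a Newton trajectory backwards, away from
  \<zeta>. Its velocity is \<open>v\<close>, a positive multiple of the conjugate of
  \<open>logderiv y\<close>, and the derivative of the norm is the inner product of \<open>v\<close>
  with y / |y|.\<close>

lemma deriv_norm_ray:
  assumes w: "cmod w < R" "w \<noteq> 0" and t: "0 < t" "t \<le> 1"
    and y: "y = g (of_real t * w)" "y \<noteq> 0"
  shows "((\<lambda>t. cmod (g (of_real t * w))) has_real_derivative
            Re (y * logderiv y) / (t * (cmod (logderiv y))\<^sup>2 * cmod y)) (at t)"
proof -
  have tw: "cmod (of_real t * w) < R" "of_real t * w \<noteq> 0"
    using norm_ray_less[OF w(1)] t w by auto
  define v where "v = 1 / (of_real t * logderiv y)"
  have "(g has_field_derivative deriv g (of_real t * w)) (at (of_real t * w))"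
    by (rule holomorphic_derivI[OF g_hol]) (use tw in auto)
  moreover have "((\<lambda>t. of_real t * w) has_vector_derivative w) (at t)"
    by (auto intro!: derivative_eq_intros)
  ultimately have "((\<lambda>t. g (of_real t * w)) has_vector_derivative w * deriv g (of_real t * w)) (at t)"
    using field_vector_diff_chain_at[of "\<lambda>t. of_real t * w" w t g] by (simp add: o_def)
  also have "w * deriv g (of_real t * w) = v"
    using w by (simp add: deriv_g[OF tw] v_def y)
  finally have "((\<lambda>t. g (of_real t * w)) has_derivative (\<lambda>h. h *\<^sub>R v)) (at t)"
    by (simp add: has_vector_derivative_def)
  from has_derivative_compose[OF this has_derivative_norm] y
  have "((\<lambda>t. cmod (g (of_real t * w))) has_derivative (\<lambda>h. (h *\<^sub>R v) \<bullet> sgn y)) (at t)"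
    by simp
  moreover have "v \<bullet> sgn y = Re (y * logderiv y) / (t * (cmod (logderiv y))\<^sup>2 * cmod y)"
  proof -
    have "v = cnj (logderiv y) / (of_real t * of_real ((cmod (logderiv y))\<^sup>2))"
      unfolding v_def complex_norm_square
      using deriv_g(2)[OF tw] t by (simp add: y divide_simps)
    hence v: "v = (1 / (t * (cmod (logderiv y))\<^sup>2)) *\<^sub>R cnj (logderiv y)"
      by (simp add: scaleR_conv_of_real)
    show ?thesis unfolding v sgn_div_norm
      by (simp add: inner_complex_def field_simps diff_divide_distrib)
  qed
  moreover have "(\<lambda>h. (h *\<^sub>R v) \<bullet> sgn y) = (*) (v \<bullet> sgn y)" by (simp add: fun_eq_iff mult.commute)
  ultimately show ?thesis unfolding has_field_derivative_def by metis
qed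

lemma continuous_on_norm_ray:
  assumes "cmod w < R"
  shows "continuous_on {0..1} (\<lambda>t. cmod (g (of_real t * w)))"
  using norm_ray_less[OF assms]
  by (intro continuous_intros continuous_on_compose2[OF holomorphic_on_imp_continuous_on[OF g_hol]]) auto

text \<open>Outside the unit disc the Newton flow points strictly inwards.\<close>

lemma norm_ray_no_return:
  assumes w: "cmod w < R" "w \<noteq> 0" and \<tau>: "0 < \<tau>" "\<tau> < 1" and gw: "cmod (g w) > 1"
  shows "cmod (g (of_real \<tau> * w)) \<noteq> cmod (g w)"
proof
  assume eq: "cmod (g (of_real \<tau> * w)) = cmod (g w)"
  define h where "h = (\<lambda>t. cmod (g (of_real t * w)))"
  have h_eq: "h \<tau> = h 1" "h 1 > 1" using eq gw by (auto simp: h_def)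
  have "continuous_on {\<tau>..1} h"
    unfolding h_def by (rule continuous_on_subset[OF continuous_on_norm_ray[OF w(1)]]) (use \<tau> in auto)
  then obtain m where m: "m \<in> {\<tau>..1}" "\<And>t. t \<in> {\<tau>..1} \<Longrightarrow> h t \<le> h m"
    using continuous_attains_sup[of "{\<tau>..1}" h] \<tau> by auto
  \<comment> \<open>If the maximum is attained at 1, it is attained at \<open>\<tau>\<close> as
    well. So there is a maximiser n < 1, where the positive derivative of h gives larger values just
    to the right.\<close>
  define n where "n = (if m = 1 then \<tau> else m)"
  have n: "\<tau> \<le> n" "n < 1" "\<And>t. t \<in> {\<tau>..1} \<Longrightarrow> h t \<le> h n"
    using m \<tau> h_eq by (auto simp: n_def)
  define y where "y = g (of_real n * w)"
  have y: "cmod y > 1" using n(3)[of \<tau>] n(1,2) h_eq by (auto simp: h_def y_def)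
  hence y0: "y \<noteq> 0" by auto
  have n0: "n > 0" using n \<tau> by simp
  have nw: "cmod (of_real n * w) < R" "of_real n * w \<noteq> 0"
    using norm_ray_less[OF w(1), of n] n0 n w by auto
  have "0 < d * cmod y / (1 + cmod y)" using y d2 by (intro divide_pos_pos mult_pos_pos) auto
  also have "\<dots> \<le> Re (y * logderiv y)" by (rule Re_logderiv_ge[OF y])
  finally have pos: "0 < Re (y * logderiv y) / (n * (cmod (logderiv y))\<^sup>2 * cmod y)"
    using n0 y0 deriv_g(2)[OF nw] by (intro divide_pos_pos mult_pos_pos) (auto simp: y_def)
  have "(h has_real_derivative Re (y * logderiv y) / (n * (cmod (logderiv y))\<^sup>2 * cmod y)) (at n)"
    unfolding h_def by (rule deriv_norm_ray[OF w n0 _ y_def y0]) (use n in simp)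
  from DERIV_pos_inc_right[OF this pos] obtain e where e: "e > 0" "\<And>x. x > 0 \<Longrightarrow> x < e \<Longrightarrow> h n < h (n + x)"
    by auto
  define x where "x = min (e / 2) (1 - n)"
  have "0 < x" "x < e" "n + x \<le> 1" using e(1) n by (auto simp: x_def)
  thus False using e(2)[of x] n(1) n(3)[of "n + x"] by auto
qed

text \<open>After the last time \<open>m\<close> at which |g| \<le> B the curve stays outside the
  unit disc, and there \<open>Q\<close> does not increase. Since |f (g (t w))| = t |w|, this says
  that |f| grows at least like (1 + |z|)^d.\<close>

lemma ln_growth:
  assumes w: "cmod w < R" "w \<noteq> 0" and \<tau>: "0 < \<tau>" "\<tau> \<le> 1"
    and B: "1 \<le> B" "cmod (g (of_real \<tau> * w)) \<le> B" "B < cmod (g w)"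
  shows "d * (ln (1 + cmod (g w)) - ln (1 + B)) \<le> - ln \<tau>"
proof -
  define h where "h = (\<lambda>t. cmod (g (of_real t * w)))"
  have cont: "continuous_on {\<tau>..1} h"
    unfolding h_def by (rule continuous_on_subset[OF continuous_on_norm_ray[OF w(1)]]) (use \<tau> in auto)
  define S where "S = {t\<in>{\<tau>..1}. h t \<in> {..B}}"
  have "closed S" unfolding S_def
    using continuous_closed_preimage[OF cont, of "{..B}"] by (simp add: vimage_def Int_def)
  moreover have "bounded S" by (rule bounded_subset[of "{\<tau>..1}"]) (auto simp: S_def)
  moreover have "\<tau> \<in> S" using B \<tau> by (auto simp: S_def h_def)
  ultimately obtain m where m: "m \<in> S" "\<And>t. t \<in> S \<Longrightarrow> t \<le> m"
    using compact_attains_sup[of S] by (auto simp: compact_eq_bounded_closed)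
  have m': "\<tau> \<le> m" "m \<le> 1" "h m \<le> B" "0 < m" using m \<tau> by (auto simp: S_def)
  have "h 1 > B" using B by (simp add: h_def)
  hence m1: "m < 1" using m' by (cases "m = 1") auto
  have gt: "h t > B" if "m < t" "t \<le> 1" for t
    using m(2)[of t] that m' by (force simp: S_def)
  define Q where "Q = (\<lambda>t. d * ln (1 + h t) - ln t)"
  have "Q 1 \<le> Q m"
  proof (rule DERIV_nonpos_imp_decreasing_open[of m 1 Q])
    have "1 + h t \<noteq> 0" for t using norm_ge_zero[of "g (of_real t * w)"] unfolding h_def by linarith
    thus "continuous_on {m..1} Q" unfolding Q_def
      by (intro continuous_intros continuous_on_subset[OF cont]) (use m' in auto)
    fix t assume t: "m < t" "t < 1"
    define y where "y = g (of_real t * w)"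
    have y: "cmod y > 1" using gt[of t] t B by (simp add: h_def y_def)
    hence y0: "y \<noteq> 0" by auto
    have t0: "t > 0" using t m' by simp
    define u where "u = cmod (logderiv y)"
    define X where "X = Re (y * logderiv y)"
    have "u > 0" using deriv_g(2)[of "of_real t * w"] norm_ray_less[OF w(1), of t] t t0 w
      by (auto simp: u_def y_def)
    have X_le: "d * cmod y / (1 + cmod y) \<le> X" unfolding X_def by (rule Re_logderiv_ge[OF y])
    have X0: "X > 0" using y d2 by (intro less_le_trans[OF _ X_le] divide_pos_pos mult_pos_pos) auto
    have "X \<le> cmod y * u" unfolding X_def u_def norm_mult[symmetric] by (rule complex_Re_le_cmod)
    \<comment> \<open>Replacing one factor of X * X by its lower bound leaves an inequality linear
      in X, as is the derivative of \<open>Q\<close>.\<close>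
    hence "X * X \<le> (cmod y * u) * (cmod y * u)" using X0 by (intro mult_mono) auto
    moreover have "d * cmod y / (1 + cmod y) * X \<le> X * X" using X_le X0 by (intro mult_right_mono) auto
    ultimately have "d * cmod y * X / (1 + cmod y) \<le> cmod y * (u\<^sup>2 * cmod y)"
      by (simp add: power2_eq_square algebra_simps)
    hence "cmod y * (d * X / (1 + cmod y)) \<le> cmod y * (u\<^sup>2 * cmod y)" by (simp add: algebra_simps)
    hence le: "d * X / (1 + cmod y) \<le> u\<^sup>2 * cmod y" using y by (subst (asm) mult_le_cancel_left_pos) auto
    have "(h has_real_derivative X / (t * u\<^sup>2 * cmod y)) (at t)"
      unfolding h_def X_def u_def by (rule deriv_norm_ray[OF w t0 _ y_def y0]) (use t in simp)
    moreover have "h t = cmod y" by (simp add: h_def y_def)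
    ultimately have "(Q has_real_derivative d * (X / (t * u\<^sup>2 * cmod y) / (1 + cmod y)) - 1 / t) (at t)"
      unfolding Q_def using t0 y by (auto intro!: derivative_eq_intros simp: mult_ac)
    moreover have "d * (X / (t * u\<^sup>2 * cmod y) / (1 + cmod y)) - 1 / t = (d * X / (1 + cmod y) - u\<^sup>2 * cmod y) / (t * u\<^sup>2 * cmod y)"
      using t0 y0 \<open>u > 0\<close> by (simp add: diff_divide_distrib mult_ac)
    moreover have "\<dots> \<le> 0"
      using le t0 by (intro divide_nonpos_nonneg mult_nonneg_nonneg) auto
    ultimately show "\<exists>y. (Q has_real_derivative y) (at t) \<and> y \<le> 0" by metis
  qed (use m' in auto)
  hence "d * ln (1 + h 1) \<le> d * ln (1 + h m) - ln m" by (simp add: Q_def)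
  moreover have "d * ln (1 + h m) \<le> d * ln (1 + B)"
    using m' B by (intro mult_left_mono) (auto simp: h_def intro!: ln_le_cancel_iff[THEN iffD2] add_pos_nonneg)
  moreover have "ln \<tau> \<le> ln m" using m' \<tau> by simp
  ultimately show ?thesis by (simp add: h_def algebra_simps)
qed

end

section \<open>Points omitted by the branch\<close>

context inverse_branch
begin

text \<open>Along the circle the argument of \<open>f\<close> grows at least at rate \<open>d / 2\<close>, so on a longer arc two
  points lie over the same ray; the trajectory joining them would leave the circle and come back.\<close>

lemma arc_not_subset:
  assumes \<rho>: "\<rho> > 1"
  shows "\<exists>\<theta>. \<bar>\<theta> - \<theta>0\<bar> \<le> 2 * pi / d \<and> of_real \<rho> * cis \<theta> \<notin> g ` ball 0 R"
proof (rule ccontr)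
  assume neg: "\<not> ?thesis"
  define h where "h = 2 * pi / d"
  have h: "h > 0" "d * h = 2 * pi" "2 * h \<le> 2 * pi" using d2 by (auto simp: h_def field_simps)
  have arc: "of_real \<rho> * cis \<theta> \<in> g ` ball 0 R" if "\<theta>0 - h \<le> \<theta>" "\<theta> \<le> \<theta>0 + h" for \<theta>
    using neg that by (auto simp: h_def abs_le_iff)
  \<comment> \<open>Here v = a / z for the point z = \<rho> cis \<theta>, so z - a = z (1 -
    v).\<close>
  define v where "v = (\<lambda>a \<theta>. a * exp (- (\<i> * of_real \<theta>)) / of_real \<rho>)"
  have v_less: "cmod (v a \<theta>) \<le> 1 / \<rho>" if "a \<in> Z" for a \<theta>
    using Z_le[OF that] \<rho> by (simp add: v_def norm_mult norm_divide divide_right_mono)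
  have v_less_1: "cmod (v a \<theta>) < 1" if "a \<in> Z" for a \<theta>
    using v_less[OF that, of \<theta>] \<rho> by (auto intro: le_less_trans)
  \<comment> \<open>A smooth logarithm of f / \<rho>^d along the circle: |v| < 1 keeps 1 - v in the
    right half-plane, away from the cut of \<open>Ln\<close>. Its imaginary part
    \<open>\<phi>\<close> is a continuous argument of f.\<close>
  define T where "T = (\<lambda>\<theta>::real. \<Sum>a\<in>Z. \<i> * of_real \<theta> + Ln (1 - v a \<theta>))"
  have exp_T: "poly f (of_real \<rho> * cis \<theta>) = of_real (\<rho> ^ d) * exp (T \<theta>)" for \<theta>
  proof -
    have "exp (T \<theta>) = (\<Prod>a\<in>Z. (of_real \<rho> * cis \<theta> - a) / of_real \<rho>)"
      unfolding T_def exp_sum[OF fin]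
    proof (intro prod.cong refl)
      fix a assume "a \<in> Z"
      hence "1 - v a \<theta> \<noteq> 0" using v_less_1[of a \<theta>] by auto
      hence "exp (\<i> * of_real \<theta> + Ln (1 - v a \<theta>)) = cis \<theta> * (1 - v a \<theta>)"
        by (simp add: exp_add cis_conv_exp)
      also have "cis \<theta> * v a \<theta> = a / of_real \<rho>"
        by (simp add: v_def cis_conv_exp exp_minus)
      hence "cis \<theta> * (1 - v a \<theta>) = (of_real \<rho> * cis \<theta> - a) / of_real \<rho>"
        using \<rho> by (simp add: algebra_simps diff_divide_distrib)
      finally show "exp (\<i> * of_real \<theta> + Ln (1 - v a \<theta>)) = (of_real \<rho> * cis \<theta> - a) / of_real \<rho>" .
    qed
    also have "\<dots> = poly f (of_real \<rho> * cis \<theta>) / of_real (\<rho> ^ d)"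
      by (simp add: poly_f prod_dividef card_Z)
    finally show ?thesis using \<rho> by simp
  qed
  have deriv_T: "(T has_vector_derivative (\<Sum>a\<in>Z. \<i> / (1 - v a \<theta>))) (at \<theta>)" for \<theta>
    unfolding T_def
  proof (rule has_vector_derivative_sum)
    fix a assume a: "a \<in> Z"
    have pos: "Re (1 - v a \<theta>) > 0"
      using v_less_1[OF a, of \<theta>] complex_Re_le_cmod[of "v a \<theta>"] by simp
    hence nz: "1 - v a \<theta> \<noteq> 0" by auto
    have "((\<lambda>x. a * exp (- (\<i> * x)) / of_real \<rho>) has_field_derivative - \<i> * v a \<theta>) (at (of_real \<theta>))"
      unfolding v_def using \<rho> by (auto intro!: derivative_eq_intros)
    hence 1: "(v a has_vector_derivative - \<i> * v a \<theta>) (at \<theta>)"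
      unfolding v_def by (rule has_vector_derivative_real_field)
    have 2: "((\<lambda>x. Ln (1 - x)) has_field_derivative - 1 / (1 - v a \<theta>)) (at (v a \<theta>))"
      using pos by (auto intro!: derivative_eq_intros simp: complex_nonpos_Reals_iff inverse_eq_divide)
    have "((\<lambda>\<theta>. Ln (1 - v a \<theta>)) has_vector_derivative (- \<i> * v a \<theta>) * (- 1 / (1 - v a \<theta>))) (at \<theta>)"
      using field_vector_diff_chain_at[OF 1 2] by (simp add: o_def)
    moreover have "((\<lambda>\<theta>. \<i> * of_real \<theta>) has_vector_derivative \<i>) (at \<theta>)"
      by (auto intro!: derivative_eq_intros)
    ultimately have "((\<lambda>\<theta>. \<i> * of_real \<theta> + Ln (1 - v a \<theta>)) has_vector_derivative
        \<i> + (- \<i> * v a \<theta>) * (- 1 / (1 - v a \<theta>))) (at \<theta>)"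
      by (intro has_vector_derivative_add)
    also have "\<i> + (- \<i> * v a \<theta>) * (- 1 / (1 - v a \<theta>)) = \<i> / (1 - v a \<theta>)"
      using nz by (simp add: field_simps)
    finally show "((\<lambda>\<theta>. \<i> * of_real \<theta> + Ln (1 - v a \<theta>)) has_vector_derivative \<i> / (1 - v a \<theta>)) (at \<theta>)" .
  qed
  define \<phi> where "\<phi> = (\<lambda>\<theta>. Im (T \<theta>))"
  have deriv_\<phi>: "(\<phi> has_real_derivative (\<Sum>a\<in>Z. Re (1 / (1 - v a \<theta>)))) (at \<theta>)" for \<theta>
  proof -
    have "(\<phi> has_vector_derivative Im (\<Sum>a\<in>Z. \<i> / (1 - v a \<theta>))) (at \<theta>)"
      unfolding \<phi>_def by (rule bounded_linear.has_vector_derivative[OF bounded_linear_Im deriv_T])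
    also have "Im (\<Sum>a\<in>Z. \<i> / (1 - v a \<theta>)) = (\<Sum>a\<in>Z. Re (1 / (1 - v a \<theta>)))"
      unfolding Im_sum by (intro sum.cong refl) (simp add: Im_divide Re_divide)
    finally show ?thesis by (simp add: has_real_derivative_iff_has_vector_derivative)
  qed
  have deriv_\<phi>_ge: "d * (\<rho> / (1 + \<rho>)) \<le> (\<Sum>a\<in>Z. Re (1 / (1 - v a \<theta>)))" for \<theta>
  proof -
    have "\<rho> / (1 + \<rho>) \<le> Re (1 / (1 - v a \<theta>))" if "a \<in> Z" for a
    proof -
      have "\<rho> / (1 + \<rho>) = 1 / (1 + 1 / \<rho>)" using \<rho> by (simp add: field_simps)
      also have "\<dots> \<le> 1 / (1 + cmod (v a \<theta>))"
        using v_less[OF that, of \<theta>] \<rho> by (intro divide_left_mono mult_pos_pos add_pos_nonneg) auto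
      also have "\<dots> \<le> Re (1 / (1 - v a \<theta>))" by (rule Re_inverse_one_minus_ge[OF v_less_1[OF that]])
      finally show ?thesis .
    qed
    hence "(\<Sum>a\<in>Z. \<rho> / (1 + \<rho>)) \<le> (\<Sum>a\<in>Z. Re (1 / (1 - v a \<theta>)))" by (rule sum_mono)
    thus ?thesis by (simp add: card_Z)
  qed
  define \<theta>1 where "\<theta>1 = \<theta>0 - h"
  have less: "\<theta>1 < \<theta>0 + h" using h by (simp add: \<theta>1_def)
  obtain x where x: "\<phi> (\<theta>0 + h) - \<phi> \<theta>1 = (\<theta>0 + h - \<theta>1) * (\<Sum>a\<in>Z. Re (1 / (1 - v a x)))"
    using MVT2[OF less deriv_\<phi>] by blast
  \<comment> \<open>Since \<rho> / (1 + \<rho>) > 1 / 2, the argument of f gains more than 2 \<pi>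
    on the arc of angle 2 h = 4 \<pi> / d.\<close>
  have "2 * pi < 4 * pi * (\<rho> / (1 + \<rho>))" using \<rho> by (simp add: field_simps)
  also have "\<dots> = (2 * h) * (d * (\<rho> / (1 + \<rho>)))" using h(2) by (simp add: algebra_simps)
  also have "\<dots> \<le> (2 * h) * (\<Sum>a\<in>Z. Re (1 / (1 - v a x)))"
    using h deriv_\<phi>_ge by (intro mult_left_mono) auto
  also have "\<dots> = \<phi> (\<theta>0 + h) - \<phi> \<theta>1" unfolding x by (simp add: \<theta>1_def)
  finally have big: "\<phi> \<theta>1 + 2 * pi < \<phi> (\<theta>0 + h)" by simp
  have "continuous_on {\<theta>1..\<theta>0 + h} \<phi>"
    by (intro continuous_at_imp_continuous_on ballI DERIV_isCont[OF deriv_\<phi>])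
  then obtain \<theta>2 where \<theta>2: "\<theta>1 \<le> \<theta>2" "\<theta>2 \<le> \<theta>0 + h" "\<phi> \<theta>2 = \<phi> \<theta>1 + 2 * pi"
    using IVT'[of \<phi> \<theta>1 "\<phi> \<theta>1 + 2 * pi" "\<theta>0 + h"] big less by (auto simp: less_imp_le)
  \<comment> \<open>The second inequality must be strict: for d = 2 the arc is the whole circle and
    its end points coincide.\<close>
  have \<theta>12: "\<theta>1 < \<theta>2" "\<theta>2 < \<theta>0 + h" using \<theta>2 big by (auto simp: order.order_iff_strict)
  define z1 z2 where "z1 = of_real \<rho> * cis \<theta>1" "z2 = of_real \<rho> * cis \<theta>2"
  have norm_z: "cmod z1 = \<rho>" "cmod z2 = \<rho>" using \<rho> by (auto simp: z1_z2_def norm_mult)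
  have ne: "z1 \<noteq> z2"
  proof
    assume "z1 = z2"
    hence "cis (\<theta>2 - \<theta>1) = 1" using \<rho> by (simp add: z1_z2_def flip: cis_divide)
    hence "cos (\<theta>2 - \<theta>1) = 1" by (simp add: complex_eq_iff)
    then obtain n :: int where n: "\<theta>2 - \<theta>1 = n * (2 * pi)" using cos_one_2pi_int[of "\<theta>2 - \<theta>1"] by auto
    have "0 < n * (2 * pi)" "n * (2 * pi) < 1 * (2 * pi)"
      using \<theta>12 h unfolding n[symmetric] by (auto simp: \<theta>1_def)
    hence "0 < real_of_int n" "real_of_int n < 1"
      by (simp_all add: zero_less_mult_iff)
    hence "0 < n" "n < 1" by simp_all
    thus False by simp
  qed
  obtain w1 where w1: "z1 = g w1" "cmod w1 < R"
    using arc[of \<theta>1] less by (auto simp: z1_z2_def \<theta>1_def)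
  obtain w2 where w2: "z2 = g w2" "cmod w2 < R"
    using arc[of \<theta>2] \<theta>12 by (auto simp: z1_z2_def \<theta>1_def)
  define \<kappa> where "\<kappa> = exp (Re (T \<theta>2) - Re (T \<theta>1))"
  have \<kappa>: "\<kappa> > 0" by (simp add: \<kappa>_def)
  have "T \<theta>2 = T \<theta>1 + of_real (Re (T \<theta>2) - Re (T \<theta>1)) + of_real (2 * pi) * \<i>"
    using \<theta>2(3) by (simp add: complex_eq_iff \<phi>_def)
  hence "exp (T \<theta>2) = exp (T \<theta>1) * of_real \<kappa> * exp (of_real (2 * pi) * \<i>)"
    by (metis \<kappa>_def exp_add exp_of_real)
  hence "poly f z2 = of_real \<kappa> * poly f z1"
    unfolding z1_z2_def exp_T by simp
  hence w12: "w2 = of_real \<kappa> * w1" using w1 w2 f_g by simp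
  have "w1 \<noteq> 0" "w2 \<noteq> 0"
    using norm_z \<rho> w1 w2 g0 Z_le[OF \<zeta>] by auto
  consider "\<kappa> = 1" | "\<kappa> < 1" | "\<kappa> > 1" by linarith
  thus False
  proof cases
    case 1
    thus False using w12 w1 w2 ne by simp
  next
    case 2
    show False using norm_ray_no_return[OF w1(2) \<open>w1 \<noteq> 0\<close> \<kappa> 2] w12 w1 w2 norm_z \<rho> by simp
  next
    case 3
    have "w1 = of_real (1 / \<kappa>) * w2" using \<kappa> by (simp add: w12)
    thus False using norm_ray_no_return[OF w2(2) \<open>w2 \<noteq> 0\<close>, of "1 / \<kappa>"] 3 w1 w2 norm_z \<rho> by simp
  qed
qed

text \<open>From \<zeta> move radially to the unit circle, rotate by at most 2 \<pi> / d to the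
  direction given by \<open>arc_not_subset\<close>, and move out by \<epsilon>, half of the
  available slack.\<close>

lemma omitted_near_root:
  assumes "\<delta> > 1 - cmod \<zeta> + 2 * pi / d"
  shows "\<exists>b. b \<notin> g ` ball 0 R \<and> cmod (\<zeta> - b) < \<delta>"
proof -
  define \<epsilon> where "\<epsilon> = (\<delta> - (1 - cmod \<zeta> + 2 * pi / d)) / 2"
  have \<epsilon>: "\<epsilon> > 0" using assms by (simp add: \<epsilon>_def)
  obtain \<theta> where \<theta>: "\<bar>\<theta> - Arg \<zeta>\<bar> \<le> 2 * pi / d" "of_real (1 + \<epsilon>) * cis \<theta> \<notin> g ` ball 0 R"
    using arc_not_subset[of "1 + \<epsilon>" "Arg \<zeta>"] \<epsilon> by auto
  have \<zeta>_eq: "\<zeta> = of_real (cmod \<zeta>) * cis (Arg \<zeta>)" using rcis_cmod_Arg[of \<zeta>] by (simp add: rcis_def)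
  have "\<zeta> - of_real (1 + \<epsilon>) * cis \<theta> =
      (of_real (cmod \<zeta> - 1) * cis (Arg \<zeta>) + (cis (Arg \<zeta>) - cis \<theta>)) - of_real \<epsilon> * cis \<theta>"
    by (subst \<zeta>_eq) (simp add: algebra_simps)
  also have "cmod \<dots> \<le> cmod (of_real (cmod \<zeta> - 1) * cis (Arg \<zeta>)) + cmod (cis (Arg \<zeta>) - cis \<theta>)
      + cmod (of_real \<epsilon> * cis \<theta>)"
    by (rule order_trans[OF norm_triangle_ineq4 add_right_mono[OF norm_triangle_ineq]])
  also have "\<dots> \<le> (1 - cmod \<zeta>) + 2 * pi / d + \<epsilon>"
    using \<theta>(1) norm_cis_diff_le[of "Arg \<zeta>" \<theta>] Z_le[OF \<zeta>] \<epsilon> by (simp add: norm_mult del: of_real_diff)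
  also have "\<dots> < \<delta>" using \<epsilon> by (simp add: \<epsilon>_def field_simps)
  finally show ?thesis using \<theta>(2) by blast
qed

text \<open>Koebe growth with omitted points whose distance to \<zeta> is as close to the bound as
  desired. Dividing e by K + 1 rather than K covers the case K = 0.\<close>

lemma branch_growth:
  assumes w: "cmod w < R" and s: "s = cmod w / R"
  shows "cmod (g w - \<zeta>) \<le> 4 * s / (1 - s)\<^sup>2 * (1 - cmod \<zeta> + 2 * pi / d)"
proof (rule field_le_epsilon)
  fix e :: real assume e: "e > 0"
  define K where "K = 4 * s / (1 - s)\<^sup>2"
  define c where "c = 1 - cmod \<zeta> + 2 * pi / d"
  have K: "K \<ge> 0" using R by (simp add: K_def s)
  obtain b where b: "b \<notin> g ` ball 0 R" "cmod (\<zeta> - b) < c + e / (K + 1)"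
    using omitted_near_root[of "c + e / (K + 1)"] e K by (auto simp: c_def)
  have "cmod (g w - \<zeta>) \<le> K * cmod (\<zeta> - b)"
    using Koebe_growth_omitted[OF R g_hol g_inj b(1) w s] by (simp add: K_def g0)
  also have "\<dots> \<le> K * (c + e / (K + 1))" using b(2) K by (intro mult_left_mono) auto
  also have "\<dots> \<le> K * c + e" using e K by (simp add: field_simps)
  finally show "cmod (g w - \<zeta>) \<le> 4 * s / (1 - s)\<^sup>2 * (1 - cmod \<zeta> + 2 * pi / d) + e"
    by (simp add: K_def c_def)
qed

text \<open>Koebe's quarter theorem with |g' 0| = 1 / |f' \<zeta>|. The bound does not depend on the
  branch, so the radii of all branches have a supremum.\<close>

lemma branch_radius_le: "R \<le> 4 * (2 + 2 * pi / d) * cmod (poly (pderiv f) \<zeta>)"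
proof -
  have "1 - cmod \<zeta> + 2 * pi / d < 2 + 2 * pi / d" using norm_ge_zero[of \<zeta>] by linarith
  from omitted_near_root[OF this]
  obtain b where b: "b \<notin> g ` ball 0 R" "cmod (\<zeta> - b) < 2 + 2 * pi / d" by blast
  have "R * cmod (deriv g 0) \<le> 4 * cmod (\<zeta> - b)"
    using Koebe_quarter[OF R g_hol g_inj b(1)] by (simp add: g0)
  also have "\<dots> \<le> 4 * (2 + 2 * pi / d)" using b(2) by simp
  finally have "R * cmod (deriv g 0) * cmod (poly (pderiv f) \<zeta>) \<le> 4 * (2 + 2 * pi / d) * cmod (poly (pderiv f) \<zeta>)"
    by (rule mult_right_mono) simp
  moreover have "cmod (poly (pderiv f) \<zeta>) * cmod (deriv g 0) = 1"
    using deriv_f_g[of 0] R by (simp add: g0 flip: norm_mult)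
  ultimately show ?thesis by (simp add: mult_ac)
qed

end

subsection \<open>Basins and inverse branches\<close>

text \<open>The local extensions agree on overlaps by the identity theorem, since two overlapping
  discs centred on the sphere also meet inside \<open>ball 0 R\<close>. Compactness then turns the
  union of the discs into a uniform collar.\<close>

lemma holomorphic_extend_past_sphere:
  fixes g :: "complex \<Rightarrow> complex"
  assumes R: "R > 0" and hol: "g holomorphic_on ball 0 R"
    and ext: "\<And>w. cmod w = R \<Longrightarrow> \<exists>e>0. \<exists>h. h holomorphic_on ball w e \<and> (\<forall>x\<in>ball w e \<inter> ball 0 R. h x = g x)"
  obtains R' G where "R' > R" "G holomorphic_on ball 0 R'" "\<And>x. cmod x < R \<Longrightarrow> G x = g x"
proof -
  have "\<forall>w. \<exists>e h. cmod w = R \<longrightarrow> e > 0 \<and> h holomorphic_on ball w e \<and> (\<forall>x\<in>ball w e \<inter> ball 0 R. h x = g x)"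
    using ext by metis
  then obtain e h where "\<forall>w. cmod w = R \<longrightarrow>
      e w > 0 \<and> h w holomorphic_on ball w (e w) \<and> (\<forall>x\<in>ball w (e w) \<inter> ball 0 R. h w x = g x)"
    unfolding choice_iff by blast
  hence eh: "\<And>w. cmod w = R \<Longrightarrow> e w > 0" "\<And>w. cmod w = R \<Longrightarrow> h w holomorphic_on ball w (e w)"
      "\<And>w x. cmod w = R \<Longrightarrow> x \<in> ball w (e w) \<Longrightarrow> cmod x < R \<Longrightarrow> h w x = g x"
    by auto
  have consistent: "h w x = h v x"
    if "cmod w = R" "cmod v = R" and x: "x \<in> ball w (e w)" "x \<in> ball v (e v)" for w v x
  proof (cases "w = v")
    case False
    let ?C = "ball w (e w) \<inter> ball v (e v)"
    \<comment> \<open>Dividing the chord from w to v in the ratio of the two radii puts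
      \<open>p\<close> into both discs; as an interior point of a chord it lies inside
      \<open>ball 0 R\<close>.\<close>
    define l where "l = e w / (e w + e v)"
    have e: "e w > 0" "e v > 0" using eh that by auto
    hence l: "0 < l" "l < 1" by (auto simp: l_def field_simps)
    define p where "p = w + l *\<^sub>R (v - w)"
    have dist: "dist w v < e w + e v" using x dist_triangle_less_add[of w x "e w" v "e v"] by (auto simp: dist_commute)
    have "p \<in> open_segment w v"
      unfolding in_segment(2) using False l by (auto simp: p_def algebra_simps intro!: exI[of _ l])
    hence "cmod p < R"
      using dist_decreases_open_segment[of p w v 0] that by (auto simp: dist_norm)
    moreover have "p \<in> ball w (e w)"
    proof -
      have "dist w p = l * dist w v" using l by (simp add: p_def dist_norm norm_minus_commute)
      also have "\<dots> < l * (e w + e v)" using dist l by simp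
      finally show ?thesis using e by (simp add: l_def)
    qed
    moreover have "p \<in> ball v (e v)"
    proof -
      have "v - p = (1 - l) *\<^sub>R (v - w)" by (simp add: p_def algebra_simps)
      hence "dist v p = (1 - l) * dist w v" using l by (simp add: dist_norm norm_minus_commute)
      also have "\<dots> < (1 - l) * (e w + e v)" using dist l by simp
      also have "\<dots> = e v" using e by (simp add: l_def field_simps)
      finally show ?thesis by simp
    qed
    ultimately have ne: "?C \<inter> ball 0 R \<noteq> {}" by auto
    show ?thesis
    proof (rule analytic_continuation_open[of "?C \<inter> ball 0 R" ?C "h w" "h v"])
      show "connected ?C" by (intro convex_connected convex_Int convex_ball)
      show "h w holomorphic_on ?C" "h v holomorphic_on ?C"
        using eh(2) that by (auto intro: holomorphic_on_subset)
      show "h w z = h v z" if "z \<in> ?C \<inter> ball 0 R" for z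
        using that eh(3)[of w z] eh(3)[of v z] \<open>cmod w = R\<close> \<open>cmod v = R\<close> by auto
    qed (use ne x in auto)
  qed simp
  define c where "c = (\<lambda>x. SOME w. cmod w = R \<and> x \<in> ball w (e w))"
  have c: "cmod (c x) = R" "x \<in> ball (c x) (e (c x))" if "cmod w = R" "x \<in> ball w (e w)" for x w
    using someI[of "\<lambda>w. cmod w = R \<and> x \<in> ball w (e w)" w] that unfolding c_def by auto
  define G where "G = (\<lambda>x. if cmod x < R then g x else h (c x) x)"
  have G_eq: "G x = h w x" if "cmod w = R" "x \<in> ball w (e w)" for w x
    using eh(3)[OF that] consistent[OF that(1) c(1)[OF that] that(2) c(2)[OF that]] by (auto simp: G_def)
  define U where "U = ball 0 R \<union> (\<Union>w\<in>sphere 0 R. ball w (e w))"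
  have "G holomorphic_on ball 0 R" by (rule holomorphic_transform[OF hol]) (auto simp: G_def)
  moreover have "G holomorphic_on ball w (e w)" if "w \<in> sphere 0 R" for w
    by (rule holomorphic_transform[OF eh(2)]) (use that G_eq in auto)
  ultimately have G_hol: "G holomorphic_on U" unfolding U_def
    by (intro holomorphic_on_Un holomorphic_on_UN_open) auto
  have "open U" by (auto simp: U_def)
  have sub: "cball 0 R \<subseteq> U"
  proof
    fix x :: complex assume "x \<in> cball 0 R"
    then consider "x \<in> ball 0 R" | "cmod x = R" by force
    thus "x \<in> U"
    proof cases
      case 2
      hence "x \<in> ball x (e x)" using eh(1) by simp
      thus ?thesis using 2 unfolding U_def by (intro UnI2 UN_I[of x]) auto
    qed (simp add: U_def)
  qed
  obtain \<delta> where \<delta>: "\<delta> > 0" "(\<Union>x\<in>cball 0 R. ball x \<delta>) \<subseteq> U"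
    using compact_subset_open_imp_ball_epsilon_subset[OF compact_cball \<open>open U\<close> sub] by blast
  have "ball 0 (R + \<delta>) \<subseteq> U"
  proof
    fix y :: complex assume y: "y \<in> ball 0 (R + \<delta>)"
    show "y \<in> U"
    proof (cases "cmod y \<le> R")
      case True
      thus ?thesis using sub by auto
    next
      case False
      hence y0: "y \<noteq> 0" using R by auto
      define x where "x = (R / cmod y) *\<^sub>R y"
      have x: "cmod x = R" using y0 R by (simp add: x_def)
      have "x - y = (R / cmod y - 1) *\<^sub>R y" by (simp add: x_def algebra_simps)
      moreover have "\<bar>R / cmod y - 1\<bar> = 1 - R / cmod y" using False R y0 by (simp add: abs_if divide_less_eq)
      ultimately have "dist x y = (1 - R / cmod y) * cmod y" by (simp add: dist_norm)
      also have "\<dots> = cmod y - R" using y0 by (simp add: field_simps)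
      finally have "y \<in> ball x \<delta>" using y by simp
      thus ?thesis using x by (intro subsetD[OF \<delta>(2)] UN_I[of x]) auto
    qed
  qed
  hence "G holomorphic_on ball 0 (R + \<delta>)" by (rule holomorphic_on_subset[OF G_hol])
  thus ?thesis using \<delta>(1) by (intro that[of "R + \<delta>" G]) (simp_all add: G_def)
qed

lemma holomorphic_on_poly: "poly p holomorphic_on A" for p :: "complex poly"
  unfolding holomorphic_on_def field_differentiable_def
  by (blast intro: has_field_derivative_at_within poly_DERIV)

lemma deriv_poly: "deriv (poly p) z = poly (pderiv p) z" for p :: "complex poly"
  by (rule DERIV_imp_deriv) (rule poly_DERIV)

lemma poly_locally_injective:
  fixes p :: "complex poly"
  assumes "poly (pderiv p) y \<noteq> 0"
  obtains r where "r > 0" "open (poly p ` ball y r)" "inj_on (poly p) (ball y r)"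
  using has_complex_derivative_locally_invertible[OF holomorphic_on_poly UNIV_I open_UNIV, of p y] assms
  by (auto simp: deriv_poly)

section \<open>Newton trajectories as lifts of rays\<close>

context inverse_branch
begin

lemma tendsto_branch_ray: "((\<lambda>t::real. g (exp (- of_real t) * x)) \<longlongrightarrow> \<zeta>) at_top"
proof -
  have "isCont g 0"
    using holomorphic_on_imp_continuous_on[OF g_hol] R by (simp add: continuous_on_eq_continuous_at)
  moreover have "((\<lambda>t::real. exp (- of_real t) * x) \<longlongrightarrow> 0) at_top"
  proof (rule tendsto_mult_left_zero, rule tendsto_norm_zero_cancel)
    show "((\<lambda>t::real. norm (exp (- of_real t :: complex))) \<longlongrightarrow> 0) at_top"
      by (simp add: filterlim_compose[OF exp_at_bot filterlim_uminus_at_bot_at_top])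
  qed
  ultimately show ?thesis using isCont_tendsto_compose[of 0 g] by (simp add: g0)
qed

text \<open>Under f the Newton flow becomes the linear flow x \<mapsto> exp (- t) x, so g carries
  rays to trajectories tending to g 0 = \<zeta>.\<close>

lemma branch_in_Basin:
  assumes x: "cmod x < R"
  shows "g x \<in> Basin f \<zeta>"
proof -
  define \<gamma> where "\<gamma> = (\<lambda>t::real. g (exp (- of_real t) * x))"
  have less: "cmod (exp (- of_real t) * x) < R" if "t \<ge> 0" for t :: real
    using norm_ray_less[OF x, of "exp (- t)"] that by (simp flip: exp_of_real)
  have "poly (pderiv f) (\<gamma> t) \<noteq> 0 \<and>
      (\<gamma> has_vector_derivative - (poly f (\<gamma> t) / poly (pderiv f) (\<gamma> t))) (at t within {0..})"
    if t: "t \<ge> 0" for t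
  proof -
    let ?y = "exp (- of_real t) * x"
    have *: "poly (pderiv f) (\<gamma> t) * deriv g ?y = 1" using deriv_f_g[OF less[OF t]] by (simp add: \<gamma>_def)
    have "(g has_field_derivative deriv g ?y) (at ?y)"
      by (rule holomorphic_derivI[OF g_hol]) (use less[OF t] in auto)
    moreover have "((\<lambda>t. exp (- of_real t) * x) has_vector_derivative - ?y) (at t)"
    proof (rule has_vector_derivative_real_field)
      show "((\<lambda>t. exp (- t) * x) has_field_derivative - ?y) (at (of_real t))"
        by (auto intro!: derivative_eq_intros)
    qed
    ultimately have "(\<gamma> has_vector_derivative - ?y * deriv g ?y) (at t)"
      using field_vector_diff_chain_at[of "\<lambda>t. exp (- of_real t) * x" "- ?y" t g] by (simp add: o_def \<gamma>_def)
    moreover have "- ?y * deriv g ?y = - (poly f (\<gamma> t) / poly (pderiv f) (\<gamma> t))"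
    proof -
      have "poly (pderiv f) (\<gamma> t) \<noteq> 0" using * by auto
      hence "deriv g ?y = 1 / poly (pderiv f) (\<gamma> t)" using * by (simp add: field_simps)
      thus ?thesis using f_g[OF less[OF t]] by (simp add: \<gamma>_def)
    qed
    ultimately show ?thesis using * by (auto intro: has_vector_derivative_at_within)
  qed
  moreover have "\<gamma> 0 = g x" by (simp add: \<gamma>_def)
  ultimately have "newton_trajectory f (g x) \<gamma>" by (simp add: newton_trajectory_def)
  moreover have "(\<gamma> \<longlongrightarrow> \<zeta>) at_top"
    unfolding \<gamma>_def by (rule tendsto_branch_ray)
  ultimately show ?thesis by (auto simp: Basin_def)
qed

text \<open>The trajectory \<open>\<gamma>\<close> and the lift \<open>\<eta>\<close> of the ray
  through f z have the same image under f. They agree for large t, because f is injective near the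
  simple root \<zeta>. Local injectivity along \<open>\<gamma>\<close> makes the set of agreement
  open and closed in [0, \<infinity>), so it contains 0.\<close>

lemma Basin_in_branch:
  assumes z: "z \<in> Basin f \<zeta>" and less: "cmod (poly f z) < R"
  shows "z = g (poly f z)"
proof -
  define w where "w = poly f z"
  obtain \<gamma> where \<gamma>: "newton_trajectory f z \<gamma>" "(\<gamma> \<longlongrightarrow> \<zeta>) at_top"
    using z by (auto simp: Basin_def)
  have \<gamma>0: "\<gamma> 0 = z" and reg: "\<And>t. t \<ge> 0 \<Longrightarrow> poly (pderiv f) (\<gamma> t) \<noteq> 0"
    and der: "\<And>t. t \<ge> 0 \<Longrightarrow> (\<gamma> has_vector_derivative - (poly f (\<gamma> t) / poly (pderiv f) (\<gamma> t))) (at t within {0..})"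
    using \<gamma>(1) by (auto simp: newton_trajectory_def)
  have cont: "continuous_on {0..} \<gamma>"
    using der by (intro continuous_on_vector_derivative) auto
  have f_\<gamma>: "poly f (\<gamma> t) = exp (- of_real t) * w" if t: "t \<ge> 0" for t
  proof -
    have "((\<lambda>t. exp (of_real t) * poly f (\<gamma> t)) has_vector_derivative 0) (at s within {0..})" if s: "s \<in> {0..}" for s
    proof -
      have 1: "((\<lambda>t. poly f (\<gamma> t)) has_vector_derivative - poly f (\<gamma> s)) (at s within {0..})"
        using field_vector_diff_chain_within[OF der[of s] has_field_derivative_at_within[OF poly_DERIV[of f]]]
          reg[of s] s by (simp add: o_def)
      have 2: "((\<lambda>t. exp (of_real t) :: complex) has_vector_derivative exp (of_real s)) (at s within {0..})"
        by (rule has_vector_derivative_at_within, rule has_vector_derivative_real_field)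
           (auto intro!: derivative_eq_intros)
      show ?thesis using has_vector_derivative_mult[OF 2 1] by simp
    qed
    then obtain c where c: "\<And>s. s \<in> {0..} \<Longrightarrow> exp (of_real s) * poly f (\<gamma> s) = c"
      using has_derivative_zero_constant[of "{0..}" "\<lambda>t. exp (of_real t) * poly f (\<gamma> t)"]
      by (auto simp: has_vector_derivative_def)
    have "c = w" using c[of 0] by (simp add: \<gamma>0 w_def)
    thus ?thesis using c[of t] t by (simp add: exp_minus field_simps)
  qed
  define \<eta> where "\<eta> = (\<lambda>t::real. g (exp (- of_real t) * w))"
  have less': "cmod (exp (- of_real t) * w) < R" if "t \<ge> 0" for t :: real
    using norm_ray_less[of w "exp (- t)"] less that by (simp add: w_def flip: exp_of_real)
  have f_\<eta>: "poly f (\<eta> t) = exp (- of_real t) * w" if "t \<ge> 0" for t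
    using f_g[OF less'[OF that]] by (simp add: \<eta>_def)
  have cont': "continuous_on {0..} \<eta>" unfolding \<eta>_def
    by (intro continuous_on_compose2[OF holomorphic_on_imp_continuous_on[OF g_hol]] continuous_intros)
       (use less' in auto)
  have lim: "(\<eta> \<longlongrightarrow> \<zeta>) at_top"
    unfolding \<eta>_def by (rule tendsto_branch_ray)
  define A where "A = {t \<in> {0..}. \<gamma> t - \<eta> t = 0}"
  have "closedin (top_of_set {0..}) A" unfolding A_def
    by (rule continuous_closedin_preimage_constant[OF continuous_on_diff[OF cont cont']])
  moreover have "openin (top_of_set {0..}) A"
  proof (subst openin_subopen, intro ballI)
    fix t assume t: "t \<in> A"
    hence t': "t \<in> {0..}" "\<eta> t = \<gamma> t" by (auto simp: A_def)
    obtain r where r: "r > 0" "inj_on (poly f) (ball (\<gamma> t) r)"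
      using poly_locally_injective[OF reg[of t]] t'(1) by (metis atLeast_iff)
    let ?T = "({0..} \<inter> \<gamma> -` ball (\<gamma> t) r) \<inter> ({0..} \<inter> \<eta> -` ball (\<gamma> t) r)"
    have "openin (top_of_set {0..}) ?T"
      by (rule openin_Int[OF continuous_openin_preimage_gen[OF cont open_ball]
                             continuous_openin_preimage_gen[OF cont' open_ball]])
    moreover have "t \<in> ?T" using t' r by auto
    moreover have "?T \<subseteq> A"
    proof
      fix s assume "s \<in> ?T"
      hence s: "s \<ge> 0" "\<gamma> s \<in> ball (\<gamma> t) r" "\<eta> s \<in> ball (\<gamma> t) r" by auto
      hence "\<gamma> s = \<eta> s" using f_\<gamma>[OF s(1)] f_\<eta>[OF s(1)] by (simp add: inj_onD[OF r(2) _ s(2,3)])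
      thus "s \<in> A" using s by (simp add: A_def)
    qed
    ultimately show "\<exists>T. openin (top_of_set {0..}) T \<and> t \<in> T \<and> T \<subseteq> A" by blast
  qed
  moreover have "A \<noteq> {}"
  proof -
    obtain r where r: "r > 0" "inj_on (poly f) (ball \<zeta> r)"
      using poly_locally_injective[OF pderiv_root_nonzero[OF \<zeta>]] by blast
    have "eventually (\<lambda>t. \<gamma> t \<in> ball \<zeta> r) at_top" "eventually (\<lambda>t. \<eta> t \<in> ball \<zeta> r) at_top"
      using tendstoD[OF \<gamma>(2) r(1)] tendstoD[OF lim r(1)] by (simp_all add: dist_commute)
    hence "eventually (\<lambda>t. \<gamma> t \<in> ball \<zeta> r \<and> \<eta> t \<in> ball \<zeta> r \<and> t \<ge> 0) at_top"
      using eventually_ge_at_top[of 0] by eventually_elim auto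
    then obtain t where t: "\<gamma> t \<in> ball \<zeta> r" "\<eta> t \<in> ball \<zeta> r" "t \<ge> 0"
      using eventually_happens'[OF trivial_limit_at_top_linorder] by blast
    hence "\<gamma> t = \<eta> t" using f_\<gamma>[OF t(3)] f_\<eta>[OF t(3)] by (simp add: inj_onD[OF r(2) _ t(1,2)])
    thus ?thesis using t by (auto simp: A_def)
  qed
  moreover have "connected {0::real..}" by (simp add: convex_connected)
  ultimately have "A = {0..}" unfolding connected_clopen by blast
  hence "0 \<in> A" by simp
  thus ?thesis by (simp add: A_def \<gamma>0 \<eta>_def w_def)
qed

end

section \<open>Uniqueness and maximal extension of the branch\<close>

context disc_polynomial
begin

lemma branch_imp_inverse_branch: "branch R g \<Longrightarrow> inverse_branch Z d f \<zeta> R g"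
  by unfold_locales

text \<open>The point g x lies in the basin, and the other branch recovers every basin point whose
  f-value is in its disc.\<close>

lemma branch_unique:
  assumes "branch R g" "branch R' g'" "cmod x < R" "cmod x < R'"
  shows "g x = g' x"
proof -
  interpret a: inverse_branch Z d f \<zeta> R g using assms by unfold_locales
  interpret b: inverse_branch Z d f \<zeta> R' g' using assms by unfold_locales
  show ?thesis
    using b.Basin_in_branch[OF a.branch_in_Basin[OF assms(3)]] assms by (simp add: a.f_g)
qed

lemma local_inverse:
  assumes "poly (pderiv f) y \<noteq> 0"
  obtains r e h where "r > 0" "e > 0" "h holomorphic_on ball (poly f y) e"
    "\<And>x. x \<in> ball (poly f y) e \<Longrightarrow> poly f (h x) = x" "\<And>z. z \<in> ball y r \<Longrightarrow> h (poly f z) = z"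
proof -
  obtain r where r: "r > 0" "open (poly f ` ball y r)" "inj_on (poly f) (ball y r)"
    using poly_locally_injective[OF assms] by blast
  obtain h where h: "h holomorphic_on poly f ` ball y r" "\<And>z. z \<in> ball y r \<Longrightarrow> h (poly f z) = z"
    using holomorphic_has_inverse[OF holomorphic_on_poly open_ball r(3)] by metis
  have "poly f y \<in> poly f ` ball y r" using r by auto
  then obtain e where e: "e > 0" "ball (poly f y) e \<subseteq> poly f ` ball y r"
    using r(2) open_contains_ball by blast
  show ?thesis
  proof (rule that[OF r(1) e(1)])
    show "h holomorphic_on ball (poly f y) e" by (rule holomorphic_on_subset[OF h(1) e(2)])
    show "poly f (h x) = x" if "x \<in> ball (poly f y) e" for x
      using e(2) that h(2) by force
  qed (use h in auto)
qed

lemma ex_branch: "\<exists>R g. branch R g"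
proof -
  obtain r e h where *: "r > 0" "e > 0" "h holomorphic_on ball (poly f \<zeta>) e"
    "\<And>x. x \<in> ball (poly f \<zeta>) e \<Longrightarrow> poly f (h x) = x" "\<And>z. z \<in> ball \<zeta> r \<Longrightarrow> h (poly f z) = z"
    using local_inverse[OF pderiv_root_nonzero[OF \<zeta>]] by blast
  have "poly f \<zeta> = 0" using \<zeta> by (simp add: poly_f_eq_0_iff)
  hence "branch e h" using * *(5)[of \<zeta>] by (auto simp: branch_def)
  thus ?thesis by blast
qed

lemma norm_poly_ge:
  assumes "cmod z \<ge> 1"
  shows "(cmod z - 1) ^ d \<le> cmod (poly f z)"
proof -
  have "(\<Prod>a\<in>Z. cmod z - 1) \<le> (\<Prod>a\<in>Z. cmod (z - a))"
  proof (rule prod_mono)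
    fix a assume "a \<in> Z"
    thus "0 \<le> cmod z - 1 \<and> cmod z - 1 \<le> cmod (z - a)"
      using Z_le[of a] norm_triangle_ineq2[of z a] assms by auto
  qed
  thus ?thesis by (simp add: poly_f card_Z flip: prod_norm)
qed

text \<open>Let R be the supremum of the radii; by uniqueness the branches glue to one on
  \<open>ball 0 R\<close>. If no critical point in the closure of the basin lay over |w| = R, local
  inverses would continue g across every boundary point, and hence to a larger disc.\<close>

lemma ex_maximal_branch:
  obtains R g c where "branch R g" "poly (pderiv f) c = 0" "c \<in> closure (Basin f \<zeta>)" "cmod (poly f c) = R"
proof -
  define A where "A = {R. \<exists>g. branch R g}"
  have A_ne: "A \<noteq> {}" using ex_branch by (auto simp: A_def)
  have A_bdd: "bdd_above A"
    using inverse_branch.branch_radius_le[OF branch_imp_inverse_branch]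
    by (intro bdd_aboveI[of _ "4 * (2 + 2 * pi / d) * cmod (poly (pderiv f) \<zeta>)"]) (auto simp: A_def)
  define R where "R = Sup A"
  have R_upper: "r \<le> R" if "branch r g" for r g
    using cSup_upper[OF _ A_bdd] that by (auto simp: A_def R_def)
  have R0: "R > 0"
    using ex_branch R_upper by (metis branch_def less_le_trans)
  have "\<exists>r g. branch r g \<and> cmod x < r" if "cmod x < R" for x
    using less_cSup_iff[OF A_ne A_bdd] that by (auto simp: R_def A_def)
  then obtain r G where rG: "\<And>x. cmod x < R \<Longrightarrow> branch (r x) (G x)" "\<And>x. cmod x < R \<Longrightarrow> cmod x < r x"
    by metis
  define g where "g = (\<lambda>x. G x x)"
  have g_eq: "g y = G x y" if "cmod x < R" "cmod y < r x" for x y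
  proof -
    have "cmod y < R" using that R_upper[OF rG(1)[OF that(1)]] by simp
    thus ?thesis unfolding g_def using branch_unique rG that by blast
  qed
  have g: "branch R g" unfolding branch_def
  proof (intro conjI ballI R0)
    show "g 0 = \<zeta>" using rG(1)[of 0] R0 by (auto simp: g_def branch_def)
    show "poly f (g x) = x" if "x \<in> ball 0 R" for x
      using rG(1)[of x] rG(2)[of x] that by (auto simp: g_def branch_def)
    have "g holomorphic_on (\<Union>x\<in>ball 0 R. ball 0 (r x))"
    proof (rule holomorphic_on_UN_open)
      fix x :: complex assume x: "x \<in> ball 0 R"
      have "G x holomorphic_on ball 0 (r x)" using rG(1)[of x] x by (auto simp: branch_def)
      thus "g holomorphic_on ball 0 (r x)"
        by (rule holomorphic_transform) (use g_eq[of x] x in auto)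
    qed auto
    thus "g holomorphic_on ball 0 R"
      by (rule holomorphic_on_subset) (use rG(2) in auto)
  qed
  interpret inverse_branch Z d f \<zeta> R g using g by unfold_locales
  note result = that
  show ?thesis
  proof (rule ccontr)
    assume "\<not> thesis"
    hence no_crit: "poly (pderiv f) c \<noteq> 0" if "c \<in> closure (Basin f \<zeta>)" "cmod (poly f c) = R" for c
      using result[OF g] \<open>\<not> thesis\<close> that by blast
    have "\<exists>e>0. \<exists>h. h holomorphic_on ball w e \<and> (\<forall>x\<in>ball w e \<inter> ball 0 R. h x = g x)" if w: "cmod w = R" for w
    proof -
      define t where "t = (\<lambda>n. 1 - inverse (real (Suc n)))"
      have t: "0 \<le> t n" "t n < 1" for n by (auto simp: t_def field_simps)
      have tw: "cmod (of_real (t n) * w) < R" for n using t[of n] R0 w by (simp add: norm_mult)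
      define y where "y = (\<lambda>n. g (of_real (t n) * w))"
      \<comment> \<open>Outside this disc |f| \<ge> (1 + R)^d > R, whereas |f (y n)| < R. Hence g
        has a limit point \<open>c\<close> along the radius to w.\<close>
      have "y n \<in> cball 0 (2 + R)" for n
      proof (rule ccontr)
        assume "y n \<notin> cball 0 (2 + R)"
        hence *: "1 + R \<le> cmod (y n) - 1" by simp
        have "1 + R \<le> (1 + R) ^ d" using R0 d2 self_le_power[of "1 + R" d] by simp
        also have "\<dots> \<le> (cmod (y n) - 1) ^ d" using * R0 by (intro power_mono) auto
        also have "\<dots> \<le> cmod (poly f (y n))" using * R0 by (intro norm_poly_ge) auto
        also have "\<dots> < R" using f_g[OF tw[of n]] tw[of n] by (simp add: y_def)
        finally show False by simp
      qed
      then obtain c \<sigma> where c: "strict_mono (\<sigma> :: nat \<Rightarrow> nat)" "(y \<circ> \<sigma>) \<longlonglongrightarrow> c"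
        using compact_cball[of 0 "2 + R"] unfolding compact_def by metis
      have "t \<longlonglongrightarrow> 1 - 0" unfolding t_def by (intro tendsto_intros LIMSEQ_inverse_real_of_nat)
      hence "(\<lambda>n. of_real (t n) * w) \<longlonglongrightarrow> of_real (1 - 0) * w" by (intro tendsto_intros)
      hence lim_w: "(\<lambda>n. of_real (t (\<sigma> n)) * w) \<longlonglongrightarrow> w"
        using LIMSEQ_subseq_LIMSEQ[OF _ c(1)] by (fastforce simp: o_def)
      have "(\<lambda>n. poly f (y (\<sigma> n))) \<longlonglongrightarrow> poly f c" using c(2) by (intro tendsto_intros) (simp add: o_def)
      hence fc: "poly f c = w"
        using lim_w f_g[OF tw] unfolding y_def by (simp add: LIMSEQ_unique)
      have "c \<in> closure (Basin f \<zeta>)"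
        unfolding closure_sequential using c(2) branch_in_Basin[OF tw]
        by (intro exI[of _ "y \<circ> \<sigma>"]) (auto simp: y_def)
      hence "poly (pderiv f) c \<noteq> 0" using no_crit fc w by simp
      then obtain \<rho> e h where h: "\<rho> > 0" "e > 0" "h holomorphic_on ball w e"
        "\<And>x. x \<in> ball w e \<Longrightarrow> poly f (h x) = x" "\<And>z. z \<in> ball c \<rho> \<Longrightarrow> h (poly f z) = z"
        using local_inverse[of c] unfolding fc by blast
      have "eventually (\<lambda>n. of_real (t (\<sigma> n)) * w \<in> ball w e) sequentially"
           "eventually (\<lambda>n. y (\<sigma> n) \<in> ball c \<rho>) sequentially"
        using lim_w c(2) h(1,2) by (auto simp: tendsto_iff dist_commute o_def)
      hence "eventually (\<lambda>n. of_real (t (\<sigma> n)) * w \<in> ball w e \<and> y (\<sigma> n) \<in> ball c \<rho>) sequentially"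
        by eventually_elim auto
      then obtain n where n: "of_real (t (\<sigma> n)) * w \<in> ball w e" "y (\<sigma> n) \<in> ball c \<rho>"
        by (auto simp: eventually_sequentially)
      let ?C = "ball w e \<inter> ball 0 R"
      \<comment> \<open>Where g takes values near \<open>c\<close>, the local inverse satisfies h x
        = h (f (g x)) = g x; the identity theorem extends this to the convex set
        \<open>?C\<close>.\<close>
      let ?U = "?C \<inter> (ball 0 R \<inter> g -` ball c \<rho>)"
      have "open (ball 0 R \<inter> g -` ball c \<rho>)"
        by (rule continuous_open_preimage[OF holomorphic_on_imp_continuous_on[OF g_hol] open_ball open_ball])
      hence U: "open ?U" by (rule open_Int[OF open_Int[OF open_ball open_ball]])
      have "of_real (t (\<sigma> n)) * w \<in> ?U" using n tw by (simp add: y_def)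
      hence U_ne: "?U \<noteq> {}" by blast
      have "h x = g x" if x: "x \<in> ?C" for x
      proof (rule analytic_continuation_open[OF U _ U_ne _ _ _ _ _ x])
        show "connected ?C" by (intro convex_connected convex_Int convex_ball)
        show "h holomorphic_on ?C" "g holomorphic_on ?C"
          using h(3) g_hol by (auto intro: holomorphic_on_subset)
        show "h z = g z" if "z \<in> ?U" for z using that h(5)[of "g z"] f_g[of z] by simp
      qed auto
      thus ?thesis using h by blast
    qed
    then obtain R' G' where G': "R' > R" "G' holomorphic_on ball 0 R'" "\<And>x. cmod x < R \<Longrightarrow> G' x = g x"
      using holomorphic_extend_past_sphere[OF R0 g_hol] by blast
    have "poly f (G' x) = x" if x: "x \<in> ball 0 R'" for x
    proof (rule analytic_continuation_open[of "ball 0 R" "ball 0 R'" "\<lambda>x. poly f (G' x)" "\<lambda>x. x"])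
      show "(\<lambda>x. poly f (G' x)) holomorphic_on ball 0 R'"
        using holomorphic_on_compose[OF G'(2) holomorphic_on_poly[of f]] by (simp add: o_def)
    qed (use G' R0 x f_g in \<open>auto intro: holomorphic_intros\<close>)
    hence "branch R' G'" using G' R0 g0 by (auto simp: branch_def)
    thus False using R_upper[of R' G'] G'(1) by simp
  qed
qed

lemma basin_radius_le:
  assumes "poly (pderiv f) c = 0" "c \<in> closure (Basin f \<zeta>)"
  shows "basin_radius f \<zeta> \<le> cmod (poly f c)"
proof -
  have "pderiv f \<noteq> 0" using pderiv_root_nonzero[OF \<zeta>] by auto
  hence "finite {c. poly (pderiv f) c = 0}" by (rule poly_roots_finite)
  hence "finite ((\<lambda>c. cmod (poly f c)) ` {c. poly (pderiv f) c = 0 \<and> c \<in> closure (Basin f \<zeta>)})"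
    by (auto intro: finite_subset)
  also have "(\<lambda>c. cmod (poly f c)) ` {c. poly (pderiv f) c = 0 \<and> c \<in> closure (Basin f \<zeta>)} =
      {cmod (poly f c) | c. poly (pderiv f) c = 0 \<and> c \<in> closure (Basin f \<zeta>)}" by auto
  finally show ?thesis unfolding basin_radius_def by (rule Min_le) (use assms in auto)
qed

end

subsection \<open>The lower bound\<close>

text \<open>The binomial expansion cut after the quadratic term; the induction step discards a
  nonnegative cubic term.\<close>

lemma quadratic_Bernoulli:
  fixes y :: real
  assumes "y \<ge> 0"
  shows "1 + n * y + n * (real n - 1) / 2 * y\<^sup>2 \<le> (1 + y) ^ n"
proof (induction n)
  case (Suc n)
  have "0 \<le> real n * (real n - 1)" by (cases n) auto
  hence "0 \<le> n * (real n - 1) / 2 * y ^ 3" using assms by simp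
  hence "1 + Suc n * y + Suc n * (real (Suc n) - 1) / 2 * y\<^sup>2 \<le>
      (1 + y) * (1 + n * y + n * (real n - 1) / 2 * y\<^sup>2)"
    by (simp add: field_simps power2_eq_square power3_eq_cube)
  also have "\<dots> \<le> (1 + y) * (1 + y) ^ n" using Suc assms by (intro mult_left_mono) auto
  finally show ?case by simp
qed simp

text \<open>As in the Gauss-Lucas theorem, f' / f has no zero outside the unit disc, so |c| \<le> 1
  and each factor |c - a| is at most 2.\<close>

lemma (in disc_polynomial) norm_poly_critical_le:
  assumes "poly (pderiv f) c = 0"
  shows "cmod (poly f c) \<le> 2 ^ d"
proof -
  have c: "cmod c \<le> 1"
  proof (rule ccontr)
    assume "\<not> cmod c \<le> 1"
    hence gt: "cmod c > 1" by simp
    hence "c \<notin> Z" using Z_le[of c] by auto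
    hence "logderiv c = 0" using assms by (simp add: poly_pderiv_eq poly_f_eq_0_iff)
    moreover have "0 < d * cmod c / (1 + cmod c)" using gt d2 by (intro divide_pos_pos mult_pos_pos) auto
    ultimately show False using Re_logderiv_ge[OF gt] by simp
  qed
  have "(\<Prod>a\<in>Z. cmod (c - a)) \<le> (\<Prod>a\<in>Z. 2)"
  proof (rule prod_mono)
    fix a assume "a \<in> Z"
    thus "0 \<le> cmod (c - a) \<and> cmod (c - a) \<le> 2"
      using Z_le[of a] norm_triangle_ineq4[of c a] c by auto
  qed
  thus ?thesis by (simp add: poly_f card_Z flip: prod_norm)
qed

section \<open>Points near to and far from the unit disc\<close>

context inverse_branch
begin

text \<open>The condition K \<le> 1 allows K (1 - |\<zeta>|) to be replaced by 1 - |\<zeta>|, after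
  which \<zeta> cancels.\<close>

lemma norm_branch_le:
  assumes w: "cmod w < R" and K: "K = 4 * (cmod w / R) / (1 - cmod w / R)\<^sup>2" "K \<le> 1"
  shows "cmod (g w) \<le> 1 + K * (2 * pi / d)"
proof -
  have "cmod (g w) \<le> cmod \<zeta> + cmod (g w - \<zeta>)" using norm_triangle_ineq[of \<zeta> "g w - \<zeta>"] by simp
  also have "\<dots> \<le> cmod \<zeta> + K * (1 - cmod \<zeta> + 2 * pi / d)"
    using branch_growth[OF w refl] by (simp add: K(1))
  also have "\<dots> = cmod \<zeta> + K * (1 - cmod \<zeta>) + K * (2 * pi / d)" by (simp add: algebra_simps)
  also have "\<dots> \<le> cmod \<zeta> + 1 * (1 - cmod \<zeta>) + K * (2 * pi / d)"
    using K(2) Z_le[OF \<zeta>] by (intro add_mono mult_right_mono) auto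
  finally show ?thesis by simp
qed

lemma Koebe_factor_strict_mono:
  fixes s t :: real
  assumes "0 \<le> s" "s < t" "t < 1"
  shows "4 * s / (1 - s)\<^sup>2 < 4 * t / (1 - t)\<^sup>2"
  using assms by (intro frac_less power_mono) auto

text \<open>The equation defining \<open>\<sigma>\<close> says r = 1 + K \<sigma> (2 \<pi> / d), and
  the upper bound on r means K \<sigma> \<le> 1. A smaller s would have a smaller Koebe factor and
  force |g w| < r.\<close>

lemma s_bound_le_near:
  assumes w: "cmod w < R" and r: "cmod (g w) = r" "r > 1" "r \<le> 1 + 2 * pi / d"
  shows "s_bound d r \<le> cmod w / R"
proof (rule ccontr)
  assume "\<not> s_bound d r \<le> cmod w / R"
  define s \<sigma> where "s = cmod w / R" "\<sigma> = s_bound d r"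
  define K where "K = (\<lambda>s::real. 4 * s / (1 - s)\<^sup>2)"
  have "0 < real d * (r - 1)" using r d2 by simp
  note * = least_koebe_solution(1,2)[OF this]
  have \<sigma>: "0 < \<sigma>" "\<sigma> < 1" "real d * (r - 1) = 2 * pi * K \<sigma>"
    using * r by (auto simp: s_\<sigma>_def s_bound_def K_def)
  have s: "0 \<le> s" "s < \<sigma>" using R \<open>\<not> _\<close> by (auto simp: s_\<sigma>_def)
  have "K s < K \<sigma>" unfolding K_def using Koebe_factor_strict_mono s \<sigma> by simp
  have r_eq: "r = 1 + K \<sigma> * (2 * pi / d)" using \<sigma>(3) d2 by (simp add: field_simps)
  have P: "2 * pi / d > 0" using d2 by simp
  have "K \<sigma> * (2 * pi / d) \<le> 1 * (2 * pi / d)" using r r_eq by simp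
  hence "K \<sigma> \<le> 1" using P by (simp only: mult_le_cancel_right_pos)
  hence "r \<le> 1 + K s * (2 * pi / d)"
    using norm_branch_le[OF w, of "K s"] \<open>K s < K \<sigma>\<close> r by (simp add: K_def s_\<sigma>_def)
  also have "\<dots> < 1 + K \<sigma> * (2 * pi / d)" using mult_strict_right_mono[OF \<open>K s < K \<sigma>\<close> P] by simp
  finally show False using r_eq by simp
qed

text \<open>Choosing the intermediate value \<open>1 / 13\<close> of \<open>|f| / R\<close> on the trajectory of \<open>g w\<close> makes the Koebe
  factor equal to \<open>13 / 36\<close>; from there on \<open>ln_growth\<close> is stronger than Koebe's estimate.\<close>

lemma quarter_le_far:
  assumes w: "cmod w < R" and r: "cmod (g w) > 1 + 2 * pi / d" and d4: "d \<ge> 4"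
  shows "1 / 4 \<le> cmod w / R"
proof (rule ccontr)
  assume "\<not> 1 / 4 \<le> cmod w / R"
  define s r where "s = cmod w / R" "r = cmod (g w)"
  define P where "P = 2 * pi / d"
  have P: "P > 0" using d2 by (simp add: P_def)
  have r': "r > 1 + P" using r by (simp add: s_r_def P_def)
  have s: "s < 1 / 4" using \<open>\<not> _\<close> by (simp add: s_r_def)
  have s13: "1 / 13 < s"
  proof (rule ccontr)
    assume "\<not> 1 / 13 < s"
    moreover have "s \<ge> 0" using R by (simp add: s_r_def)
    ultimately have "4 * s / (1 - s)\<^sup>2 \<le> 4 * (1 / 13) / (1 - 1 / 13)\<^sup>2"
      by (intro frac_le power_mono) auto
    hence *: "4 * s / (1 - s)\<^sup>2 \<le> 1" by (simp add: power2_eq_square)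
    have "r \<le> 1 + 4 * s / (1 - s)\<^sup>2 * P"
      using norm_branch_le[OF w _ *] by (simp add: s_r_def P_def)
    also have "\<dots> \<le> 1 + 1 * P" using * P by (intro add_left_mono mult_right_mono) auto
    finally show False using r' by simp
  qed
  define \<tau> where "\<tau> = 1 / (13 * s)"
  have \<tau>: "0 < \<tau>" "\<tau> \<le> 1" using s13 by (auto simp: \<tau>_def)
  have w0: "w \<noteq> 0" using s13 by (auto simp: s_r_def)
  have "cmod (of_real \<tau> * w) = \<tau> * cmod w" using \<tau> by (simp add: norm_mult)
  also have "\<dots> = R / 13" using w0 R by (simp add: \<tau>_def s_r_def)
  finally have norm_\<tau>w: "cmod (of_real \<tau> * w) = R / 13" .
  hence \<tau>w: "cmod (of_real \<tau> * w) < R" using R by simp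
  have "(13 / 36 :: real) = 4 * (cmod (of_real \<tau> * w) / R) / (1 - cmod (of_real \<tau> * w) / R)\<^sup>2"
    unfolding norm_\<tau>w using R by (simp add: power2_eq_square)
  from norm_branch_le[OF \<tau>w this] have le: "cmod (g (of_real \<tau> * w)) \<le> 1 + 13 / 36 * P"
    by (simp add: P_def)
  have "d * (ln (1 + r) - ln (2 + 13 / 36 * P)) \<le> - ln \<tau>"
    using ln_growth[OF w w0 \<tau> _ le] P r' by (simp add: s_r_def)
  moreover have "ln (1 + r) - ln (2 + 13 / 36 * P) = ln ((1 + r) / (2 + 13 / 36 * P))"
    using P r' by (simp add: ln_div)
  moreover have "- ln \<tau> = ln (13 * s)" using s13 by (simp add: \<tau>_def ln_div)
  ultimately have "ln (((1 + r) / (2 + 13 / 36 * P)) ^ d) \<le> ln (13 * s)"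
    using P r' by (simp add: ln_realpow)
  hence upper: "((1 + r) / (2 + 13 / 36 * P)) ^ d \<le> 13 * s"
    using P r' s13 by (subst (asm) ln_le_cancel_iff) auto
  \<comment> \<open>Chosen so that 1 + y = (2 + P) / (2 + 13/36 P), the growth ratio with r lowered
    to 1 + P. Since s < 1 / 4 the upper bound is below 13 / 4, so (1 + y)^d \<ge> 13 / 4
    suffices.\<close>
  define y where "y = (23 / 36 * P) / (2 + 13 / 36 * P)"
  have y0: "y \<ge> 0" using P by (simp add: y_def)
  \<comment> \<open>Multiplying numerator and denominator of y by d / 2 gives the right-hand side;
    then 23/36 \<pi> \<ge> 2 and 13/36 \<pi> \<le> 6/5.\<close>
  have "2 / (d + 6 / 5) \<le> (23 / 36 * pi) / (d + 13 / 36 * pi)"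
    using pi_approx by (intro frac_le) (auto simp: add_pos_pos)
  also have "\<dots> = y" using d2 by (simp add: y_def P_def field_simps)
  finally have y_ge: "2 / (d + 6 / 5) \<le> y" .
  \<comment> \<open>Both expressions increase with d, and the constants are their values at d =
    4.\<close>
  have "20 / 13 \<le> d * (2 / (d + 6 / 5))" "15 / 13 \<le> (real d - 1) * (2 / (d + 6 / 5))"
    using d4 by (simp_all add: field_simps)
  moreover have "d * (2 / (d + 6 / 5)) \<le> d * y" "(real d - 1) * (2 / (d + 6 / 5)) \<le> (real d - 1) * y"
    using y_ge d2 by (intro mult_left_mono; simp)+
  ultimately have dy: "20 / 13 \<le> d * y" "15 / 13 \<le> (real d - 1) * y" by linarith+
  have "(20 / 13) * (15 / 13) \<le> (d * y) * ((real d - 1) * y)" using dy y0 by (intro mult_mono) auto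
  moreover have "d * (real d - 1) / 2 * y\<^sup>2 = (d * y) * ((real d - 1) * y) / 2"
    by (simp add: power2_eq_square)
  ultimately have "13 / 4 \<le> 1 + d * y + d * (real d - 1) / 2 * y\<^sup>2"
    using dy(1) by linarith
  also have "\<dots> \<le> (1 + y) ^ d" by (rule quadratic_Bernoulli[OF y0])
  also have "1 + y = (2 + P) / (2 + 13 / 36 * P)" using P by (simp add: y_def field_simps)
  also have "\<dots> ^ d \<le> ((1 + r) / (2 + 13 / 36 * P)) ^ d"
    using r' P by (intro power_mono divide_right_mono) auto
  finally show False using upper s by simp
qed

end

text \<open>The maximal R is |f c| for a critical point c in the closure of the basin, so it is at
  least the basin radius and a lower bound for |f z| / R suffices. If |f z| \<ge> R this is
  immediate from s < 1; otherwise z = g (f z).\<close>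

lemma (in disc_polynomial) norm_poly_ge_basin_radius:
  assumes z: "z \<in> Basin f \<zeta>" and r: "cmod z = r" "r > 1"
  shows "s_bound d r * basin_radius f \<zeta> \<le> cmod (poly f z)"
proof -
  obtain R g c where branch: "branch R g" and c: "poly (pderiv f) c = 0" "c \<in> closure (Basin f \<zeta>)" "cmod (poly f c) = R"
    by (rule ex_maximal_branch)
  interpret inverse_branch Z d f \<zeta> R g using branch by unfold_locales
  have s01: "0 < s_bound d r" "s_bound d r < 1" using s_bound_less_1[of d r] d2 r by auto
  have "s_bound d r * basin_radius f \<zeta> \<le> s_bound d r * R"
    using basin_radius_le[OF c(1,2)] c(3) s01 by (intro mult_left_mono) auto
  also have "\<dots> \<le> cmod (poly f z)"
  proof (cases "cmod (poly f z) < R")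
    case False
    have "s_bound d r * R \<le> 1 * R" using s01 R by (intro mult_right_mono) auto
    thus ?thesis using False by simp
  next
    case True
    note gw = Basin_in_branch[OF z True]
    have "s_bound d r \<le> cmod (poly f z) / R"
    proof (cases "r \<le> 1 + 2 * pi / d")
      case near: True
      thus ?thesis using s_bound_le_near[OF True] gw r by simp
    next
      case far: False
      have "d \<ge> 4"
      proof (rule ccontr)
        assume "\<not> d \<ge> 4"
        hence "d = 2 \<or> d = 3" using d2 by auto
        hence "2 \<le> 2 * pi / d" using pi_approx by auto
        hence "2 ^ d \<le> (r - 1) ^ d" using far by (intro power_mono) auto
        also have "\<dots> \<le> cmod (poly f z)" using norm_poly_ge[of z] r by simp
        finally show False using True norm_poly_critical_le[OF c(1)] c(3) by simp
      qed
      thus ?thesis using quarter_le_far[OF True] gw far r by (simp add: s_bound_def)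
    qed
    thus ?thesis using R by (simp add: field_simps)
  qed
  finally show ?thesis .
qed

theorem proposition5p13:
  fixes d :: nat and f :: "complex poly" and \<zeta> z :: complex and r :: real
  assumes "d \<ge> 2"
    and "f \<in> polys_in_unit_disk d"
    and "poly f \<zeta> = 0"
    and "z \<in> Basin f \<zeta>"
    and "cmod z = r"
    and "r > 1"
  shows "cmod (poly f z) \<ge> s_bound d r * basin_radius f \<zeta>"
proof -
  obtain Z where Z: "finite Z" "card Z = d" "\<And>a. a \<in> Z \<Longrightarrow> cmod a \<le> 1" "f = (\<Prod>a\<in>Z. [:- a, 1:])"
    using assms(2) by (auto simp: polys_in_unit_disk_def)
  have "\<zeta> \<in> Z" using assms(3) Z(1) by (auto simp: Z(4) poly_prod)
  then interpret disc_polynomial Z d f \<zeta>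
    using Z assms(1) by unfold_locales auto
  show ?thesis using norm_poly_ge_basin_radius assms(4-6) by blast
qed

end
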